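(* For every $s\ge0$ and every $E\in\mathcal{F}_s$, the quantities $\mathbb{P}_t(E)$ and $\mathbb{Q}_t(E)$ converge as $t\to\infty$; denote the limits by $\mathbb{P}_\infty(E)$ and $\mathbb{Q}_\infty(E)$, respectively. Moreover, $\mathbb{P}_\infty$ and $\mathbb{Q}_\infty$ extend to probability measures on the $\sigma$-algebra $\mathcal{F}$, and $\mathbb{P}_\infty=\mathbb{Q}_\infty$.
   Context: $\mathbb{N}_0$ denotes the canonical measure of super-Brownian motion on $\mathbb{R}^d$ started at the origin, with unit branching and diffusion rates. It is a $\sigma$-finite (infinite) measure on continuous paths $(X_t)_{t\ge0}$ from $[0,\infty)$ into the finite non-negative measures on $\mathbb{R}^d$ (weak topology), not charging the zero path, with $X_0=0$, characterised as follows. For bounded measurable $f\ge0$ let $u^f(t,x)$ be the mild solution of $\partial_tu=\frac{1}{2d}\Delta u-\frac12u^2$, $u(0,\cdot)=f$. Super-Brownian motion with initial measure $\mu$ is the Markov process with law $\mathbb{P}_\mu$ satisfying $\mathbb{E}_\mu[e^{-X_t(f)}]=\exp(-\int u^f(t,x)\mu(dx))$. Under $\mathbb{N}_0$, for $t>0$, $\mathbb{N}_0(1-e^{-X_t(f)})=u^f(t,0)$, and for $s>0$, given $(X_u)_{u\le s}$, the process $(X_{s+t})_{t\ge0}$ has law $\mathbb{P}_{X_s}$. In particular $\mathbb{N}_0(X_t(1))=1$ and $\mathbb{N}_0(I[X_t(1)>0])=2/t$ for $t>0$. Here $X_t(f)=\int f\,dX_t$, so $X_t(1)$ is the total mass,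 and $\mathbb{N}_0(F)$ denotes the integral of $F$ with respect to $\mathbb{N}_0$; $I[\cdot]$ is the indicator. $\mathcal{F}_s=\sigma(X_u:0\le u\le s)$ and $\mathcal{F}$ is the $\sigma$-algebra generated by $\bigcup_{s\ge0}\mathcal{F}_s$. For $t>0$ and an event $E\in\mathcal{F}_s$ (some $s<\infty$), define $$\mathbb{P}_t(E)=\frac{\mathbb{N}_0(I[E]X_t(1))}{\mathbb{N}_0(X_t(1))},\qquad \mathbb{Q}_t(E)=\frac{\mathbb{N}_0(I[E]\,I[X_t(1)>0])}{\mathbb{N}_0(I[X_t(1)>0])}.$$ *)

theory Defs
  imports "HOL-Probability.Probability"
begin

definition finite_borel_measures :: "'a::euclidean_space measure set" where
  "finite_borel_measures = {\<mu>. finite_measure \<mu> \<and> sets \<mu> = sets borel}"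

definition weak_topology :: "'a::euclidean_space measure topology" where
  "weak_topology = topology_generated_by
     {{\<mu> \<in> finite_borel_measures. (\<integral>x. f x \<partial>\<mu>) \<in> U} | (f :: 'a \<Rightarrow> real) U.
        continuous_on UNIV f \<and> bounded (range f) \<and> open U}"

text \<open>The Borel \<open>\<sigma>\<close>-algebra of the weak topology; only the space and the
  measurable sets of this object matter.\<close>
definition finite_measure_algebra :: "'a::euclidean_space measure measure" where
  "finite_measure_algebra = sigma finite_borel_measures {U. openin weak_topology U}"


text \<open>A path is indexed by the non-negative reals; outside \<open>{0..}\<close> it takes the
  junk value \<open>undefined\<close>, so that equality of paths is equality on \<open>{0..}\<close>.\<close>
definition measure_paths :: "(real \<Rightarrow> 'a::euclidean_space measure) set" where
  "measure_paths = {X \<in> extensional {0..}. continuous_map (top_of_set {0..}) weak_topology X}"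

definition shift_path :: "real \<Rightarrow> (real \<Rightarrow> 'a measure) \<Rightarrow> real \<Rightarrow> 'a measure" where
  "shift_path s X = (\<lambda>t\<in>{0..}. X (s + t))"

definition path_filtration :: "real \<Rightarrow> (real \<Rightarrow> 'a::euclidean_space measure) measure" where
  "path_filtration s = sigma measure_paths
     {{X \<in> measure_paths. X r \<in> A} | r A. 0 \<le> r \<and> r \<le> s \<and> A \<in> sets finite_measure_algebra}"

definition path_algebra :: "(real \<Rightarrow> 'a::euclidean_space measure) measure" where
  "path_algebra = sigma measure_paths (\<Union>s\<in>{0..}. sets (path_filtration s))"


text \<open>With \<open>d = DIM('a)\<close>, the semigroup with generator \<open>(1 / (2 d)) \<Delta>\<close> is
  convolution with the centred Gaussian density of covariance \<open>(t / d) I\<close>.\<close>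
definition heat_kernel :: "real \<Rightarrow> 'a::euclidean_space \<Rightarrow> real" where
  "heat_kernel t x = (real DIM('a) / (2 * pi * t)) powr (real DIM('a) / 2)
     * exp (- (real DIM('a) * (norm x)\<^sup>2 / (2 * t)))"

definition heat_semigroup :: "real \<Rightarrow> ('a::euclidean_space \<Rightarrow> real) \<Rightarrow> 'a \<Rightarrow> real" where
  "heat_semigroup t f x = (if t = 0 then f x else (\<integral>y. heat_kernel t (y - x) * f y \<partial>lborel))"

text \<open>Mild (integral) form of \<open>\<partial>\<^sub>t u = (1 / (2 d)) \<Delta> u - u\<^sup>2 / 2\<close>, \<open>u(0, \<cdot>) = f\<close>, in the
  usual uniqueness class of non-negative measurable functions that are bounded on
  \<open>[0, T] \<times> \<real>\<^sup>d\<close> for each \<open>T\<close>. Only the values \<open>u t x\<close> with \<open>t \<ge> 0\<close> are constrained.\<close>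
definition mild_solution ::
  "('a::euclidean_space \<Rightarrow> real) \<Rightarrow> (real \<Rightarrow> 'a \<Rightarrow> real) \<Rightarrow> bool" where
  "mild_solution f u \<longleftrightarrow>
     (\<lambda>(t, x). u t x) \<in> borel_measurable (restrict_space borel ({0..} \<times> UNIV)) \<and>
     (\<forall>t\<ge>0. \<forall>x. 0 \<le> u t x) \<and>
     (\<forall>T. \<exists>C. \<forall>t\<in>{0..T}. \<forall>x. u t x \<le> C) \<and>
     (\<forall>t\<ge>0. \<forall>x. u t x = heat_semigroup t f x
        - 1 / 2 * (LINT r:{0..t}|lborel. heat_semigroup (t - r) (\<lambda>y. (u r y)\<^sup>2) x))"

definition bounded_test_function :: "('a::euclidean_space \<Rightarrow> real) \<Rightarrow> bool" where
  "bounded_test_function f \<longleftrightarrow> f \<in> borel_measurable borel \<and> bounded (range f) \<and> (\<forall>x. 0 \<le> f x)"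


text \<open>\<open>P \<mu>\<close> is the law on path space of super-Brownian motion started from \<open>\<mu>\<close>. As part of
  being a Markov family, \<open>P\<close> is a probability kernel.\<close>
definition super_brownian_laws ::
  "('a::euclidean_space measure \<Rightarrow> (real \<Rightarrow> 'a measure) measure) \<Rightarrow> bool" where
  "super_brownian_laws P \<longleftrightarrow>
     P \<in> measurable finite_measure_algebra (prob_algebra path_algebra) \<and>
     (\<forall>\<mu>\<in>finite_borel_measures.
        (AE X in P \<mu>. X 0 = \<mu>) \<and>
        (\<forall>f u t. bounded_test_function f \<longrightarrow> mild_solution f u \<longrightarrow> 0 \<le> t \<longrightarrow>
           (\<integral>X. exp (- (\<integral>x. f x \<partial>X t)) \<partial>P \<mu>) = exp (- (\<integral>x. u t x \<partial>\<mu>))) \<and>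
        (\<forall>s\<ge>0. \<forall>E\<in>sets (path_filtration s). \<forall>G\<in>sets path_algebra.
           emeasure (P \<mu>) {X \<in> E. shift_path s X \<in> G}
             = (\<integral>\<^sup>+X. indicator E X * emeasure (P (X s)) G \<partial>P \<mu>)))"

text \<open>The zero measure on \<open>\<real>\<^sup>d\<close> is \<open>null_measure borel\<close>.\<close>
definition canonical_measure ::
  "('a::euclidean_space measure \<Rightarrow> (real \<Rightarrow> 'a measure) measure)
     \<Rightarrow> (real \<Rightarrow> 'a measure) measure \<Rightarrow> bool" where
  "canonical_measure P N \<longleftrightarrow>
     sets N = sets path_algebra \<and>
     sigma_finite_measure N \<and>
     emeasure N (space N) = \<infinity> \<and>
     (AE X in N. \<exists>t\<ge>0. X t \<noteq> null_measure borel) \<and>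
     (AE X in N. X 0 = null_measure borel) \<and>
     (\<forall>f u t. bounded_test_function f \<longrightarrow> mild_solution f u \<longrightarrow> 0 < t \<longrightarrow>
        (\<integral>\<^sup>+X. ennreal (1 - exp (- (\<integral>x. f x \<partial>X t))) \<partial>N) = ennreal (u t 0)) \<and>
     (\<forall>s>0. \<forall>E\<in>sets (path_filtration s). \<forall>G\<in>sets path_algebra.
        emeasure N {X \<in> E. shift_path s X \<in> G}
          = (\<integral>\<^sup>+X. indicator E X * emeasure (P (X s)) G \<partial>N))"


definition mass_biased ::
  "(real \<Rightarrow> 'a::euclidean_space measure) measure \<Rightarrow> real \<Rightarrow> (real \<Rightarrow> 'a measure) set \<Rightarrow> ennreal" where
  "mass_biased N t E =
     (\<integral>\<^sup>+X. indicator E X * emeasure (X t) UNIV \<partial>N) / (\<integral>\<^sup>+X. emeasure (X t) UNIV \<partial>N)"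

definition survival_conditioned ::
  "(real \<Rightarrow> 'a::euclidean_space measure) measure \<Rightarrow> real \<Rightarrow> (real \<Rightarrow> 'a measure) set \<Rightarrow> ennreal" where
  "survival_conditioned N t E =
     (\<integral>\<^sup>+X. indicator E X * indicator {X. emeasure (X t) UNIV > 0} X \<partial>N)
       / (\<integral>\<^sup>+X. indicator {X. emeasure (X t) UNIV > 0} X \<partial>N)"

end

theory Submission
  imports Defs "HOL-Real_Asymp.Real_Asymp"
begin

text \<open>For a constant \<open>f = \<lambda>\<close> the mild solution is \<open>u(t) = 2 \<lambda> / (2 + \<lambda> t)\<close>. Letting \<open>\<lambda> \<rightarrow> 0\<close> and
  \<open>\<lambda> \<rightarrow> \<infinity>\<close> gives mean and survival probability of the total mass under both the canonical measure
  and the laws \<open>P \<mu>\<close>. By the Markov property at time \<open>s\<close>, the mass-biased probability of an event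
  \<open>E\<close> known at time \<open>s\<close> equals \<open>N(1\<^sub>E X\<^sub>s(1))\<close> for all \<open>t \<ge> s\<close>, and conditioning on survival
  gives \<open>(t / 2) N(1\<^sub>E (1 - exp (- 2 X\<^sub>s(1) / (t - s))))\<close>, which converges to the same quantity.

  It remains to extend this consistent family to a measure on path space. No topological extension
  theorem is used: the Ionescu-Tulcea theorem yields a Markov chain of unit-time path pieces,
  each distributed as super-Brownian motion from the end point of its predecessor and tilted by
  its final mass. Almost surely consecutive pieces fit together, and the glued path has the required
  law, since the tilts telescope.\<close>

subsection \<open>Measurability on the path space\<close>

lemma topspace_weak_topology: "topspace weak_topology = (finite_borel_measures :: 'a::euclidean_space measure set)"
proof -
  have "finite_borel_measures \<in> {{\<mu> \<in> finite_borel_measures. (\<integral>x. f x \<partial>\<mu>) \<in> U} | (f :: 'a \<Rightarrow> real) U.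
        continuous_on UNIV f \<and> bounded (range f) \<and> open U}"
    by (intro CollectI exI[of _ "\<lambda>_. 0"] exI[of _ UNIV]) auto
  then show ?thesis
    unfolding weak_topology_def topology_generated_by_topspace by blast
qed

lemma space_finite_measure_algebra [simp]: "space finite_measure_algebra = finite_borel_measures"
  by (simp add: finite_measure_algebra_def space_measure_of_conv)

lemma openin_weak_topology_subset: "{U. openin weak_topology U} \<subseteq> Pow finite_borel_measures"
  using openin_subset[where U=weak_topology] by (auto simp: topspace_weak_topology)

lemma openin_weak_topology_sets:
  "openin weak_topology U \<Longrightarrow> U \<in> sets finite_measure_algebra"
  by (simp add: finite_measure_algebra_def openin_weak_topology_subset)

lemma measurable_integral_continuous:
  fixes f :: "'a::euclidean_space \<Rightarrow> real"
  assumes "continuous_on UNIV f" "bounded (range f)"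
  shows "(\<lambda>\<mu>. \<integral>x. f x \<partial>\<mu>) \<in> borel_measurable finite_measure_algebra"
proof (rule borel_measurableI)
  fix S :: "real set" assume "open S"
  have "openin weak_topology {\<mu> \<in> finite_borel_measures. (\<integral>x. f x \<partial>\<mu>) \<in> S}"
    unfolding weak_topology_def by (rule topology_generated_by_Basis) (use assms \<open>open S\<close> in auto)
  moreover have "(\<lambda>\<mu>. \<integral>x. f x \<partial>\<mu>) -` S \<inter> space finite_measure_algebra
      = {\<mu> \<in> finite_borel_measures. (\<integral>x. f x \<partial>\<mu>) \<in> S}"
    by auto
  ultimately show "(\<lambda>\<mu>. \<integral>x. f x \<partial>\<mu>) -` S \<inter> space finite_measure_algebra \<in> sets finite_measure_algebra"
    by (simp add: openin_weak_topology_sets)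
qed

lemma finite_borel_measuresD:
  assumes "\<mu> \<in> finite_borel_measures"
  shows "finite_measure \<mu>" "sets \<mu> = sets borel" "space \<mu> = UNIV"
  using assms sets_eq_imp_space_eq[of \<mu> borel] by (auto simp: finite_borel_measures_def)

lemma emeasure_finite_borel_measure:
  assumes "\<mu> \<in> finite_borel_measures"
  shows "emeasure \<mu> A = ennreal (measure \<mu> A)"
proof -
  interpret finite_measure \<mu> using assms by (rule finite_borel_measuresD)
  show ?thesis by (rule emeasure_eq_measure)
qed

text \<open>The truncated functions \<open>min 1 (n * infdist x (- S))\<close> are continuous and
  converge pointwise to the indicator of the open set \<open>S\<close>. Their integrals are
  measurable in \<mu>, and dominated convergence passes this on to the measure of
  \<open>S\<close>.\<close>

lemma measurable_measure_open:
  fixes S :: "'a::euclidean_space set"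
  assumes "open S"
  shows "(\<lambda>\<mu>. measure \<mu> S) \<in> borel_measurable finite_measure_algebra"
\<comment> \<open>\<open>infdist\<close> to the empty set is 0 by convention, so the approximating
  functions would vanish for \<open>S = UNIV\<close>; there the integral of the constant 1 is
  used.\<close>
proof (cases "S = UNIV")
  case True
  have "(\<lambda>\<mu>. \<integral>x. (1::real) \<partial>\<mu>) \<in> borel_measurable finite_measure_algebra"
    by (rule measurable_integral_continuous) auto
  moreover have "(\<integral>x. (1::real) \<partial>\<mu>) = measure \<mu> S"
    if "\<mu> \<in> space finite_measure_algebra" for \<mu> :: "'a measure"
    using that True by (simp add: finite_borel_measuresD)
  ultimately show ?thesis by (rule measurable_cong[THEN iffD1, rotated])
next
  case False
  define f where "f n x = min 1 (real n * infdist x (- S))" for n x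
  have cont: "continuous_on UNIV (f n)" for n
    unfolding f_def by (intro continuous_intros)
  have bdd: "bounded (range (f n))" for n
    by (rule boundedI[of _ 1]) (auto simp: f_def infdist_nonneg)
  have lim: "(\<lambda>n. f n x) \<longlonglongrightarrow> indicator S x" for x
  proof (cases "x \<in> S")
    case True
    then have "infdist x (- S) > 0"
      using in_closed_iff_infdist_zero[of "- S" x] assms False infdist_nonneg[of x "- S"]
      by (auto simp: closed_def less_le)
    then have "filterlim (\<lambda>n. real n * infdist x (- S)) at_top sequentially"
      by (intro filterlim_at_top_mult_tendsto_pos[OF tendsto_const] filterlim_real_sequentially)
    then have "eventually (\<lambda>n. 1 \<le> real n * infdist x (- S)) sequentially"
      by (simp add: filterlim_at_top)
    then have "eventually (\<lambda>n. f n x = 1) sequentially"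
      by eventually_elim (simp add: f_def)
    then show ?thesis using True by (simp add: tendsto_eventually)
  next
    case False
    then show ?thesis by (simp add: f_def)
  qed
  show ?thesis
  proof (rule borel_measurable_LIMSEQ_real)
    show "(\<lambda>\<mu>. \<integral>x. f n x \<partial>\<mu>) \<in> borel_measurable finite_measure_algebra" for n
      by (intro measurable_integral_continuous cont bdd)
    fix \<mu> :: "'a measure" assume "\<mu> \<in> space finite_measure_algebra"
    then have \<mu>: "\<mu> \<in> finite_borel_measures" by simp
    note D = finite_borel_measuresD[OF \<mu>]
    interpret finite_measure \<mu> by (rule D)
    have fm: "f n \<in> borel_measurable \<mu>" for n
      unfolding measurable_cong_sets[OF D(2) refl] by (rule borel_measurable_continuous_onI[OF cont])
    have [measurable]: "S \<in> sets \<mu>" using assms by (simp add: D)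
    have "(\<lambda>n. \<integral>x. f n x \<partial>\<mu>) \<longlonglongrightarrow> (\<integral>x. indicator S x \<partial>\<mu>)"
    proof (rule integral_dominated_convergence[where w="\<lambda>_. 1"])
      show "AE x in \<mu>. norm (f n x) \<le> 1" for n
        by (auto simp: f_def infdist_nonneg)
    qed (use lim fm in auto)
    then show "(\<lambda>n. \<integral>x. f n x \<partial>\<mu>) \<longlonglongrightarrow> measure \<mu> S"
      by (simp add: D)
  qed
qed

lemma measurable_emeasure_UNIV [measurable]:
  "(\<lambda>\<mu>. emeasure \<mu> UNIV) \<in> borel_measurable finite_measure_algebra"
proof -
  have "(\<lambda>\<mu>. ennreal (measure \<mu> UNIV)) \<in> borel_measurable finite_measure_algebra"
    using measurable_measure_open[OF open_UNIV] by measurable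
  then show ?thesis
    by (rule measurable_cong[THEN iffD1, rotated]) (simp add: emeasure_finite_borel_measure)
qed

text \<open>Finite unions from a countable basis determine a finite Borel measure, because every
  open set is an increasing union of such sets.\<close>
lemma finite_borel_measure_countable_determining:
  obtains \<B> :: "'a::euclidean_space set set"
  where "countable \<B>" "\<And>B. B \<in> \<B> \<Longrightarrow> open B"
    "\<And>\<mu> \<nu>. \<mu> \<in> finite_borel_measures \<Longrightarrow> \<nu> \<in> finite_borel_measures \<Longrightarrow>
       (\<And>B. B \<in> \<B> \<Longrightarrow> measure \<mu> B = measure \<nu> B) \<Longrightarrow> \<mu> = \<nu>"
proof -
  obtain \<A> :: "'a set set" where \<A>: "countable \<A>" "topological_basis \<A>"
    using ex_countable_basis by auto
  define \<B> where "\<B> = Union ` {F. finite F \<and> F \<subseteq> \<A>}"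
  show thesis
  proof (rule that)
    show "countable \<B>"
      unfolding \<B>_def by (intro countable_image countable_Collect_finite_subset \<A>)
    show opB: "open B" if "B \<in> \<B>" for B
      using that topological_basis_open[OF \<A>(2)] by (auto simp: \<B>_def)
    fix \<mu> \<nu> :: "'a measure"
    assume \<mu>: "\<mu> \<in> finite_borel_measures" and \<nu>: "\<nu> \<in> finite_borel_measures"
      and eq: "\<And>B. B \<in> \<B> \<Longrightarrow> measure \<mu> B = measure \<nu> B"
    note D = finite_borel_measuresD[OF \<mu>] and E = finite_borel_measuresD[OF \<nu>]
    have op: "emeasure \<mu> U = emeasure \<nu> U" if U: "open U" for U
    proof (cases "U = {}")
      case False
      obtain \<C> where \<C>: "\<C> \<subseteq> \<A>" "\<Union>\<C> = U"
        using U \<A>(2) by (auto simp: topological_basis_def)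
      then have ne: "\<C> \<noteq> {}" and cC: "countable \<C>"
        using False \<A>(1) countable_subset by auto
      define V where "V n = (\<Union>i\<le>n. from_nat_into \<C> i)" for n
      have VB: "V n \<in> \<B>" for n
        unfolding \<B>_def V_def using from_nat_into[OF ne] \<C>(1)
        by (intro image_eqI[of _ _ "from_nat_into \<C> ` {..n}"]) auto
      have VO: "V n \<in> sets borel" for n
        using opB[OF VB] by simp
      have inc: "incseq V" by (auto simp: V_def incseq_def intro: order_trans)
      have UV: "(\<Union>n. V n) = U"
      proof -
        have "(\<Union>n. V n) = \<Union>(range (from_nat_into \<C>))" by (auto simp: V_def)
        then show ?thesis using range_from_nat_into[OF ne cC] \<C>(2) by simp
      qed
      have "emeasure \<mu> U = (SUP n. emeasure \<mu> (V n))"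
        using SUP_emeasure_incseq[of V \<mu>, OF _ inc] VO by (simp add: D UV image_subset_iff)
      also have "\<dots> = (SUP n. emeasure \<nu> (V n))"
        using eq[OF VB] by (simp add: emeasure_finite_borel_measure \<mu> \<nu>)
      also have "\<dots> = emeasure \<nu> U"
        using SUP_emeasure_incseq[of V \<nu>, OF _ inc] VO by (simp add: E UV image_subset_iff)
      finally show ?thesis .
    qed simp
    show "\<mu> = \<nu>"
    proof (rule measure_eqI_generator_eq[where E="{S. open S}" and \<Omega>=UNIV and A="\<lambda>_. UNIV"])
      show "sets \<mu> = sigma_sets UNIV {S. open S}" "sets \<nu> = sigma_sets UNIV {S. open S}"
        by (simp_all add: D E borel_def)
      show "emeasure \<mu> UNIV \<noteq> \<infinity>"
        by (simp add: emeasure_finite_borel_measure[OF \<mu>])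
    qed (auto simp: Int_stable_def op)
  qed
qed

text \<open>By the countable determining class, equality of two random measures amounts to countably
  many equations between real random variables. This makes the event that consecutive path pieces
  fit together measurable.\<close>

lemma measurable_eq_finite_borel_measure:
  fixes f g :: "'b \<Rightarrow> 'a::euclidean_space measure"
  assumes [measurable]: "f \<in> measurable M finite_measure_algebra" "g \<in> measurable M finite_measure_algebra"
  shows "{x \<in> space M. f x = g x} \<in> sets M"
proof -
  obtain \<B> :: "'a set set" where \<B>: "countable \<B>" "\<And>B. B \<in> \<B> \<Longrightarrow> open B"
    "\<And>\<mu> \<nu>. \<mu> \<in> finite_borel_measures \<Longrightarrow> \<nu> \<in> finite_borel_measures \<Longrightarrow>
       (\<And>B. B \<in> \<B> \<Longrightarrow> measure \<mu> B = measure \<nu> B) \<Longrightarrow> \<mu> = \<nu>"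
    by (rule finite_borel_measure_countable_determining) blast
  have "f x \<in> finite_borel_measures" "g x \<in> finite_borel_measures" if "x \<in> space M" for x
    using assms[THEN measurable_space, OF that] by auto
  then have "{x \<in> space M. f x = g x} = {x \<in> space M. \<forall>B\<in>\<B>. measure (f x) B = measure (g x) B}"
    using \<B>(3) by auto
  moreover have "{x \<in> space M. \<forall>B\<in>\<B>. measure (f x) B = measure (g x) B} \<in> sets M"
  proof (rule sets.sets_Collect_countable_All'[OF _ \<B>(1)])
    fix B assume "B \<in> \<B>"
    then have [measurable]: "(\<lambda>\<mu>. measure \<mu> B) \<in> borel_measurable finite_measure_algebra"
      by (intro measurable_measure_open \<B>(2))
    show "{x \<in> space M. measure (f x) B = measure (g x) B} \<in> sets M"
      by measurable
  qed
  ultimately show ?thesis by simp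
qed

section \<open>Path space, its filtration and time shifts\<close>

lemma path_in_finite_borel_measures:
  "X \<in> measure_paths \<Longrightarrow> 0 \<le> t \<Longrightarrow> X t \<in> finite_borel_measures"
  using continuous_map_image_subset_topspace[of "top_of_set {0..}" weak_topology X]
  by (auto simp: measure_paths_def topspace_weak_topology)

lemma path_filtration_subset:
  "{{X \<in> measure_paths. X r \<in> A} | r A. 0 \<le> r \<and> r \<le> s \<and> A \<in> sets finite_measure_algebra}
     \<subseteq> Pow measure_paths"
  by auto

lemma space_path_filtration [simp]: "space (path_filtration s) = measure_paths"
  by (simp add: path_filtration_def space_measure_of_conv)

lemma sets_path_filtration:
  "sets (path_filtration s) = sigma_sets measure_paths
     {{X \<in> measure_paths. X r \<in> A} | r A. 0 \<le> r \<and> r \<le> s \<and> A \<in> sets finite_measure_algebra}"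
  by (simp only: path_filtration_def sets_measure_of[OF path_filtration_subset])

lemma path_filtration_mono: "s \<le> t \<Longrightarrow> sets (path_filtration s) \<subseteq> sets (path_filtration t)"
  unfolding sets_path_filtration by (rule sigma_sets_mono') (fastforce intro: order_trans)

lemma space_path_algebra [simp]: "space path_algebra = measure_paths"
  by (simp add: path_algebra_def space_measure_of_conv)

lemma path_algebra_subset: "(\<Union>s\<in>{0..}. sets (path_filtration s)) \<subseteq> Pow measure_paths"
  using sets.sets_into_space by fastforce

lemma sets_path_algebra:
  "sets path_algebra = sigma_sets measure_paths (\<Union>s\<in>{0..}. sets (path_filtration s))"
  by (simp only: path_algebra_def sets_measure_of[OF path_algebra_subset])

lemma path_filtration_le_path_algebra: "0 \<le> s \<Longrightarrow> sets (path_filtration s) \<subseteq> sets path_algebra"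
  unfolding sets_path_algebra by (auto intro: sigma_sets.Basic)

lemma measurable_path_filtration_mono:
  "s \<le> t \<Longrightarrow> f \<in> measurable (path_filtration s) N \<Longrightarrow> f \<in> measurable (path_filtration t) N"
  using path_filtration_mono by (fastforce simp: measurable_def)

lemma measurable_path_algebraI:
  "0 \<le> s \<Longrightarrow> f \<in> measurable (path_filtration s) N \<Longrightarrow> f \<in> measurable path_algebra N"
  using path_filtration_le_path_algebra by (fastforce simp: measurable_def)

lemma measurable_path_eval:
  assumes "0 \<le> r" "r \<le> s"
  shows "(\<lambda>X. X r) \<in> measurable (path_filtration s) finite_measure_algebra"
proof (rule measurableI)
  fix A :: "'a measure set" assume "A \<in> sets finite_measure_algebra"
  then have "{X \<in> measure_paths. X r \<in> A} \<in> sets (path_filtration s)"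
    unfolding sets_path_filtration using assms by (intro sigma_sets.Basic) auto
  moreover have "(\<lambda>X. X r) -` A \<inter> space (path_filtration s) = {X \<in> measure_paths. X r \<in> A}"
    by auto
  ultimately show "(\<lambda>X. X r) -` A \<inter> space (path_filtration s) \<in> sets (path_filtration s)" by simp
qed (simp add: path_in_finite_borel_measures assms)

lemma measurable_path_eval_algebra:
  "0 \<le> r \<Longrightarrow> (\<lambda>X. X r) \<in> measurable path_algebra finite_measure_algebra"
  by (rule measurable_path_algebraI[OF _ measurable_path_eval]) auto

lemma measurable_into_path_filtration:
  fixes f :: "'b \<Rightarrow> real \<Rightarrow> 'a::euclidean_space measure"
  assumes sp: "\<And>x. x \<in> space M \<Longrightarrow> f x \<in> measure_paths"
    and ev: "\<And>r. 0 \<le> r \<Longrightarrow> r \<le> s \<Longrightarrow> (\<lambda>x. f x r) \<in> measurable M finite_measure_algebra"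
  shows "f \<in> measurable M (path_filtration s)"
  unfolding path_filtration_def
proof (rule measurable_measure_of[OF path_filtration_subset])
  fix Y :: "(real \<Rightarrow> 'a measure) set"
  assume "Y \<in> {{X \<in> measure_paths. X r \<in> A} | r A. 0 \<le> r \<and> r \<le> s \<and> A \<in> sets finite_measure_algebra}"
  then obtain r A where Y: "Y = {X \<in> measure_paths. X r \<in> A}"
    and r: "0 \<le> r" "r \<le> s" and A: "A \<in> sets finite_measure_algebra"
    by auto
  have "f -` Y \<inter> space M = (\<lambda>x. f x r) -` A \<inter> space M"
    using sp by (auto simp: Y)
  then show "f -` Y \<inter> space M \<in> sets M"
    using measurable_sets[OF ev[OF r] A] by simp
qed (use sp in auto)

lemma measurable_into_path_algebra:
  fixes f :: "'b \<Rightarrow> real \<Rightarrow> 'a::euclidean_space measure"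
  assumes sp: "\<And>x. x \<in> space M \<Longrightarrow> f x \<in> measure_paths"
    and ev: "\<And>r. 0 \<le> r \<Longrightarrow> (\<lambda>x. f x r) \<in> measurable M finite_measure_algebra"
  shows "f \<in> measurable M path_algebra"
  unfolding path_algebra_def
proof (rule measurable_measure_of[OF path_algebra_subset])
  fix Y :: "(real \<Rightarrow> 'a measure) set"
  assume "Y \<in> (\<Union>s\<in>{0..}. sets (path_filtration s))"
  then obtain s where "Y \<in> sets (path_filtration s)" by auto
  moreover have "f \<in> measurable M (path_filtration s)"
    by (rule measurable_into_path_filtration) (use assms in auto)
  ultimately show "f -` Y \<inter> space M \<in> sets M" by (simp add: measurable_sets)
qed (use sp in auto)

lemma shift_path_in_measure_paths:
  assumes "X \<in> measure_paths" "0 \<le> s"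
  shows "shift_path s X \<in> measure_paths"
proof -
  have X: "continuous_map (top_of_set {0..}) weak_topology X"
    using assms by (simp add: measure_paths_def)
  have "continuous_map (top_of_set {0..}) (top_of_set {0..}) (\<lambda>t. s + t)"
    using assms by (auto intro!: continuous_intros)
  then have "continuous_map (top_of_set {0..}) weak_topology (X \<circ> (\<lambda>t. s + t))"
    by (rule continuous_map_compose[OF _ X])
  then have "continuous_map (top_of_set {0..}) weak_topology (shift_path s X)"
    by (rule continuous_map_eq) (simp add: shift_path_def)
  then show ?thesis by (simp add: measure_paths_def shift_path_def)
qed

text \<open>The shifted path up to time \<open>t\<close> reads the original path only up to time
  \<open>s + t\<close>. With \<open>t = 1\<close>, the unit piece starting at time \<open>k\<close>
  is known at time \<open>k + 1\<close>.\<close>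

lemma measurable_shift_path:
  assumes "0 \<le> s"
  shows "shift_path s \<in> measurable (path_filtration (s + t)) (path_filtration t)"
proof (rule measurable_into_path_filtration)
  fix r :: real assume r: "0 \<le> r" "r \<le> t"
  have "(\<lambda>X. X (s + r)) \<in> measurable (path_filtration (s + t)) finite_measure_algebra"
    by (rule measurable_path_eval) (use assms r in auto)
  then show "(\<lambda>X. shift_path s X r) \<in> measurable (path_filtration (s + t)) finite_measure_algebra"
    using r by (simp add: shift_path_def)
qed (simp add: shift_path_in_measure_paths assms)

lemma measurable_shift_path_algebra:
  assumes "0 \<le> s"
  shows "shift_path s \<in> measurable path_algebra path_algebra"
proof (rule measurable_into_path_algebra)
  fix r :: real assume r: "0 \<le> r"
  have "(\<lambda>X. X (s + r)) \<in> measurable path_algebra finite_measure_algebra"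
    by (rule measurable_path_eval_algebra) (use assms r in auto)
  then show "(\<lambda>X. shift_path s X r) \<in> measurable path_algebra finite_measure_algebra"
    using r by (simp add: shift_path_def)
qed (simp add: shift_path_in_measure_paths assms)

text \<open>This path shows that the path space is nonempty, as needed for \<open>bind\<close>, and
  serves as the default where pieces cannot be glued.\<close>

lemma constant_null_path: "(\<lambda>t\<in>{0..}. null_measure borel) \<in> measure_paths"
proof -
  have "(null_measure borel :: 'a measure) \<in> finite_borel_measures"
    by (auto simp: finite_borel_measures_def intro!: finite_measureI)
  then have "continuous_map (top_of_set {0::real..}) weak_topology (\<lambda>t. null_measure borel :: 'a measure)"
    by (simp add: topspace_weak_topology)
  then have "continuous_map (top_of_set {0::real..}) weak_topology (\<lambda>t\<in>{0..}. null_measure borel :: 'a measure)"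
    by (rule continuous_map_eq) simp
  then show ?thesis by (simp add: measure_paths_def)
qed

subsection \<open>Laplace transforms\<close>

text \<open>Fatou's lemma bounds the integral of the limit by the liminf, and domination by the
  limit function bounds the limsup. The measure may be infinite, as the canonical measure
  is.\<close>

lemma nn_integral_tendsto_from_below:
  fixes u :: "nat \<Rightarrow> 'a \<Rightarrow> ennreal"
  assumes [measurable]: "\<And>n. u n \<in> borel_measurable M"
    and le: "\<forall>\<^sub>F n in sequentially. \<forall>x\<in>space M. u n x \<le> f x"
    and lim: "\<And>x. x \<in> space M \<Longrightarrow> (\<lambda>n. u n x) \<longlonglongrightarrow> f x"
  shows "(\<lambda>n. \<integral>\<^sup>+x. u n x \<partial>M) \<longlonglongrightarrow> (\<integral>\<^sup>+x. f x \<partial>M)"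
proof -
  have "(\<integral>\<^sup>+x. f x \<partial>M) = (\<integral>\<^sup>+x. liminf (\<lambda>n. u n x) \<partial>M)"
    by (intro nn_integral_cong lim_imp_Liminf[symmetric] lim) auto
  also have "\<dots> \<le> liminf (\<lambda>n. \<integral>\<^sup>+x. u n x \<partial>M)"
    by (rule nn_integral_liminf) simp
  finally have 1: "(\<integral>\<^sup>+x. f x \<partial>M) \<le> liminf (\<lambda>n. \<integral>\<^sup>+x. u n x \<partial>M)" .
  have 2: "limsup (\<lambda>n. \<integral>\<^sup>+x. u n x \<partial>M) \<le> (\<integral>\<^sup>+x. f x \<partial>M)"
    using le by (intro Limsup_bounded) (auto elim!: eventually_mono intro: nn_integral_mono)
  have "liminf (\<lambda>n. \<integral>\<^sup>+x. u n x \<partial>M) \<le> limsup (\<lambda>n. \<integral>\<^sup>+x. u n x \<partial>M)"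
    by (rule Liminf_le_Limsup) simp
  then show ?thesis
    using 1 2 by (intro Liminf_eq_Limsup) (auto intro: antisym order_trans)
qed

lemma one_minus_exp_le: "1 - exp (- x) \<le> (x::real)"
  using exp_ge_add_one_self[of "- x"] by simp

text \<open>This is the derivative at 0 of \<open>1 - exp (- (h * y))\<close> in \<open>h\<close>,
  taken along \<open>h = 1 / f n\<close>. It serves both for the mean of the total mass and for the
  limit of the survival probabilities.\<close>

lemma tendsto_scaled_one_minus_exp:
  fixes f :: "'a \<Rightarrow> real" and y :: real
  assumes "filterlim f at_top F"
  shows "((\<lambda>n. f n * (1 - exp (- (y / f n)))) \<longlongrightarrow> y) F"
proof -
  have "((\<lambda>x. x * (1 - exp (- (y / x)))) \<longlongrightarrow> y) at_top"
    by real_asymp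
  then show ?thesis
    using assms by (rule filterlim_compose)
qed

text \<open>The mean is the slope at 0 of the transform \<phi>. The limit is taken along
  \<open>1 / Suc n\<close>, and \<open>one_minus_exp_le\<close> keeps the difference quotients below
  \<open>Y\<close>.\<close>

lemma laplace_mean:
  fixes Y :: "'a \<Rightarrow> real"
  assumes [measurable]: "Y \<in> borel_measurable M" and nn: "\<And>x. x \<in> space M \<Longrightarrow> 0 \<le> Y x"
    and lap: "\<And>l. 0 < l \<Longrightarrow> (\<integral>\<^sup>+x. ennreal (1 - exp (- (l * Y x))) \<partial>M) = ennreal (\<phi> l)"
    and lim: "((\<lambda>l. l * \<phi> (1 / l)) \<longlongrightarrow> a) at_top"
  shows "(\<integral>\<^sup>+x. ennreal (Y x) \<partial>M) = ennreal a"
proof -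
  have top: "filterlim (\<lambda>n. real (Suc n)) at_top sequentially"
    using filterlim_compose[OF filterlim_real_sequentially filterlim_Suc] by simp
  let ?u = "\<lambda>n x. ennreal (real (Suc n) * (1 - exp (- (Y x / real (Suc n)))))"
  have "(\<lambda>n. \<integral>\<^sup>+x. ?u n x \<partial>M) \<longlonglongrightarrow> (\<integral>\<^sup>+x. ennreal (Y x) \<partial>M)"
  proof (rule nn_integral_tendsto_from_below)
    fix x
    have "?u n x \<le> ennreal (Y x)" for n x
      using mult_left_mono[OF one_minus_exp_le[of "Y x / real (Suc n)"], of "real (Suc n)"]
      by (intro ennreal_leI) simp
    then show "\<forall>\<^sub>F n in sequentially. \<forall>x\<in>space M. ?u n x \<le> ennreal (Y x)" by simp
    show "(\<lambda>n. ?u n x) \<longlonglongrightarrow> ennreal (Y x)"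
      by (intro tendsto_ennrealI tendsto_scaled_one_minus_exp top)
  qed measurable
  moreover have "(\<integral>\<^sup>+x. ?u n x \<partial>M) = ennreal (real (Suc n) * \<phi> (1 / real (Suc n)))" for n
  proof -
    have "(\<integral>\<^sup>+x. ?u n x \<partial>M)
        = ennreal (real (Suc n)) * (\<integral>\<^sup>+x. ennreal (1 - exp (- (1 / real (Suc n) * Y x))) \<partial>M)"
      by (subst nn_integral_cmult[symmetric]) (auto simp: ennreal_mult' simp del: of_nat_Suc)
    also have "\<dots> = ennreal (real (Suc n) * \<phi> (1 / real (Suc n)))"
      by (subst lap) (auto simp: ennreal_mult' simp del: of_nat_Suc)
    finally show ?thesis .
  qed
  moreover have "(\<lambda>n. ennreal (real (Suc n) * \<phi> (1 / real (Suc n)))) \<longlonglongrightarrow> ennreal a"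
    by (intro tendsto_ennrealI filterlim_compose[OF lim top])
  ultimately show ?thesis using LIMSEQ_unique by simp
qed

text \<open>As \<open>l\<close> tends to infinity, \<open>1 - exp (- (l * Y x))\<close> tends from
  below to the indicator of \<open>0 < Y x\<close>, so the limit of \<phi> at infinity is the
  measure of that event.\<close>

lemma laplace_positive:
  fixes Y :: "'a \<Rightarrow> real"
  assumes [measurable]: "Y \<in> borel_measurable M" and nn: "\<And>x. x \<in> space M \<Longrightarrow> 0 \<le> Y x"
    and lap: "\<And>l. 0 < l \<Longrightarrow> (\<integral>\<^sup>+x. ennreal (1 - exp (- (l * Y x))) \<partial>M) = ennreal (\<phi> l)"
    and lim: "(\<phi> \<longlongrightarrow> b) at_top"
  shows "(\<integral>\<^sup>+x. indicator {x. 0 < Y x} x \<partial>M) = ennreal b"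
proof -
  have top: "filterlim (\<lambda>n. real (Suc n)) at_top sequentially"
    using filterlim_compose[OF filterlim_real_sequentially filterlim_Suc] by simp
  let ?u = "\<lambda>n x. ennreal (1 - exp (- (real (Suc n) * Y x)))"
  have "(\<lambda>n. \<integral>\<^sup>+x. ?u n x \<partial>M) \<longlonglongrightarrow> (\<integral>\<^sup>+x. indicator {x. 0 < Y x} x \<partial>M)"
  proof (rule nn_integral_tendsto_from_below)
    have "?u n x \<le> indicator {x. 0 < Y x} x" if "x \<in> space M" for n x
      using nn[OF that] by (cases "Y x = 0") (auto simp: indicator_def simp del: of_nat_Suc)
    then show "\<forall>\<^sub>F n in sequentially. \<forall>x\<in>space M. ?u n x \<le> indicator {x. 0 < Y x} x" by simp
    fix x assume x: "x \<in> space M"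
    have "((\<lambda>t::real. 1 - exp (- (t * Y x))) \<longlongrightarrow> 1) at_top" if "0 < Y x"
      using that by real_asymp
    then have "(\<lambda>n. 1 - exp (- (real (Suc n) * Y x))) \<longlonglongrightarrow> indicator {x. 0 < Y x} x"
      using nn[OF x] filterlim_compose[OF _ top]
      by (cases "Y x = 0") (auto simp: indicator_def simp del: of_nat_Suc)
    then show "(\<lambda>n. ?u n x) \<longlonglongrightarrow> indicator {x. 0 < Y x} x"
      by (subst ennreal_indicator[symmetric]) (rule tendsto_ennrealI)
  qed measurable
  moreover have "(\<integral>\<^sup>+x. ?u n x \<partial>M) = ennreal (\<phi> (real (Suc n)))" for n
    by (rule lap) simp
  moreover have "(\<lambda>n. ennreal (\<phi> (real (Suc n)))) \<longlonglongrightarrow> ennreal b"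
    by (intro tendsto_ennrealI filterlim_compose[OF lim top])
  ultimately show ?thesis using LIMSEQ_unique by simp
qed

subsection \<open>The mild solution for constant data\<close>

text \<open>The covariance is \<open>t / d\<close> times the identity, so the coordinates decouple.
  The normalisation of the kernel is thereby reduced to that of the one-dimensional normal
  density.\<close>

lemma heat_kernel_eq_prod_normal_density:
  fixes y :: "'a::euclidean_space"
  assumes t: "0 < t"
  shows "heat_kernel t y = (\<Prod>b\<in>Basis. normal_density 0 (sqrt (t / DIM('a))) (y \<bullet> b))"
proof -
  let ?d = "real DIM('a)"
  have d: "0 < ?d" by simp
  have sq: "(sqrt (t / ?d))\<^sup>2 = t / ?d" using t d by simp
  have "(\<Prod>b\<in>Basis. normal_density 0 (sqrt (t / ?d)) (y \<bullet> b))
      = (1 / sqrt (2 * pi * (t / ?d))) ^ DIM('a) * exp (\<Sum>b\<in>Basis. - (y \<bullet> b)\<^sup>2 / (2 * (t / ?d)))"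
    by (simp add: normal_density_def sq prod.distrib exp_sum prod_dividef power_divide)
  also have "(\<Sum>b\<in>Basis. - (y \<bullet> b)\<^sup>2 / (2 * (t / ?d))) = - (?d * (norm y)\<^sup>2 / (2 * t))"
  proof -
    have "(norm y)\<^sup>2 = (\<Sum>b\<in>Basis. (y \<bullet> b)\<^sup>2)"
      by (subst power2_norm_eq_inner, subst euclidean_inner) (simp add: power2_eq_square)
    then show ?thesis
      using t d by (simp add: sum_divide_distrib[symmetric] sum_negf sum_distrib_left[symmetric] field_simps)
  qed
  also have "(1 / sqrt (2 * pi * (t / ?d))) ^ DIM('a) = (?d / (2 * pi * t)) powr (?d / 2)"
  proof -
    have pos: "0 < ?d / (2 * pi * t)" using t d by simp
    have "(?d / (2 * pi * t)) powr (?d / 2) = ((?d / (2 * pi * t)) powr (1 / 2)) powr ?d"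
      by (simp add: powr_powr)
    also have "\<dots> = sqrt (?d / (2 * pi * t)) ^ DIM('a)"
      using pos by (simp add: powr_half_sqrt powr_realpow)
    also have "sqrt (?d / (2 * pi * t)) = 1 / sqrt (2 * pi * (t / ?d))"
      by (simp add: real_sqrt_divide)
    finally show ?thesis by simp
  qed
  finally show ?thesis by (simp add: heat_kernel_def)
qed

text \<open>Translation invariance of Lebesgue measure removes \<open>x\<close>; the integral then
  factorises over the coordinates into normal densities of total mass 1.\<close>

lemma integral_heat_kernel:
  fixes x :: "'a::euclidean_space"
  assumes t: "0 < t"
  shows "(\<integral>y. heat_kernel t (y - x) \<partial>lborel) = 1"
proof -
  have [measurable]: "(heat_kernel t :: 'a \<Rightarrow> real) \<in> borel_measurable borel"
    unfolding heat_kernel_def[abs_def] by measurable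
  have \<sigma>: "0 < sqrt (t / real DIM('a))" using t by simp
  have "(\<integral>\<^sup>+y. ennreal (heat_kernel t (y - x)) \<partial>lborel)
      = (\<integral>\<^sup>+y. ennreal (heat_kernel t y) \<partial>distr lborel borel ((+) (- x)))"
    by (subst nn_integral_distr) auto
  also have "\<dots> = (\<integral>\<^sup>+y. (\<Prod>b\<in>Basis. ennreal (normal_density 0 (sqrt (t / DIM('a))) ((y::'a) \<bullet> b))) \<partial>lborel)"
    by (simp add: lborel_distr_plus heat_kernel_eq_prod_normal_density[OF t] prod_ennreal)
  also have "\<dots> = (\<Prod>b\<in>(Basis :: 'a set). (\<integral>\<^sup>+y. ennreal (normal_density 0 (sqrt (t / DIM('a))) y) \<partial>lborel))"
    by (rule nn_integral_lborel_prod) auto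
  also have "\<dots> = 1"
    using \<sigma> by (simp add: nn_integral_eq_integral normal_density_nonneg)
  finally have "(\<integral>\<^sup>+y. ennreal (heat_kernel t (y - x)) \<partial>lborel) = 1" .
  then show ?thesis
    by (subst integral_eq_nn_integral) (auto simp: heat_kernel_def)
qed

lemma heat_semigroup_const: "0 \<le> t \<Longrightarrow> heat_semigroup t (\<lambda>_. c) x = c"
  by (simp add: heat_semigroup_def integral_heat_kernel)

text \<open>For spatially constant data the heat semigroup acts trivially and the equation becomes
  the ordinary differential equation \<open>u' = - u^2 / 2\<close> with \<open>u 0 = l\<close>,
  solved by separation of variables.\<close>

lemma mild_solution_const:
  fixes l :: real
  assumes l: "0 \<le> l"
  shows "mild_solution (\<lambda>_::'a::euclidean_space. l) (\<lambda>t _. 2 * l / (2 + l * t))"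
  unfolding mild_solution_def
proof (intro conjI allI impI)
  have "(\<lambda>(t, x). 2 * l / (2 + l * t)) \<in> borel_measurable (borel :: (real \<times> 'a) measure)"
    unfolding borel_prod[symmetric] by measurable
  then show "(\<lambda>(t, x). 2 * l / (2 + l * t)) \<in> borel_measurable (restrict_space borel ({0..} \<times> (UNIV :: 'a set)))"
    by (rule measurable_restrict_space1)
  show "0 \<le> 2 * l / (2 + l * t)" if "0 \<le> t" for t using that l by simp
  show "\<exists>C. \<forall>t\<in>{0..T}. \<forall>x::'a. 2 * l / (2 + l * t) \<le> C" for T
  proof (intro exI[of _ l] ballI allI)
    fix t assume "t \<in> {0..T}"
    then have "0 \<le> l * t" using l by simp
    then show "2 * l / (2 + l * t) \<le> l" using l by (simp add: divide_le_eq algebra_simps)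
  qed
  fix t :: real and x :: 'a assume t: "0 \<le> t"
  have pos: "0 < 2 + l * r" if "0 \<le> r" for r using that l by (simp add: add_pos_nonneg)
  have "(LINT r:{0..t}|lborel. heat_semigroup (t - r) (\<lambda>y::'a. (2 * l / (2 + l * r))\<^sup>2) x)
      = (\<integral>r. (2 * l / (2 + l * r))\<^sup>2 * indicator {0..t} r \<partial>lborel)"
    unfolding set_lebesgue_integral_def
    by (intro Bochner_Integration.integral_cong) (auto simp: heat_semigroup_const indicator_def)
  \<comment> \<open>The antiderivative is \<open>- 2 * u\<close>, because the differential equation
    gives \<open>u^2 = - 2 * u'\<close>.\<close>
  also have "\<dots> = (- 4 * l / (2 + l * t)) - (- 4 * l / (2 + l * 0))"
  proof (rule integral_FTC_Icc_real[OF t])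
    fix r assume r: "0 \<le> r" "r \<le> t"
    show "((\<lambda>r. - 4 * l / (2 + l * r)) has_real_derivative (2 * l / (2 + l * r))\<^sup>2) (at r)"
      using pos[OF r(1)] by (auto intro!: derivative_eq_intros simp: power2_eq_square field_simps)
    show "isCont (\<lambda>r. (2 * l / (2 + l * r))\<^sup>2) r"
      using pos[OF r(1)] by (intro continuous_intros) auto
  qed
  also have "\<dots> = 2 * (l - 2 * l / (2 + l * t))"
    using pos[OF t] by (simp add: field_simps)
  finally have "(LINT r:{0..t}|lborel. heat_semigroup (t - r) (\<lambda>y::'a. (2 * l / (2 + l * r))\<^sup>2) x)
      = 2 * (l - 2 * l / (2 + l * t))" .
  then show "2 * l / (2 + l * t) = heat_semigroup t (\<lambda>_::'a. l) x
      - 1 / 2 * (LINT r:{0..t}|lborel. heat_semigroup (t - r) (\<lambda>y::'a. (2 * l / (2 + l * r))\<^sup>2) x)"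
    using t by (simp add: heat_semigroup_const del: right_diff_distrib_numeral)
qed

lemma bounded_test_function_const: "0 \<le> l \<Longrightarrow> bounded_test_function (\<lambda>_. l)"
  by (simp add: bounded_test_function_def image_constant_conv)

subsection \<open>The total mass and the Markov property\<close>

locale super_brownian_motion =
  fixes P :: "'a::euclidean_space measure \<Rightarrow> (real \<Rightarrow> 'a measure) measure"
    and N :: "(real \<Rightarrow> 'a measure) measure"
  assumes laws: "super_brownian_laws P" and canonical: "canonical_measure P N"
begin

lemma sets_N [measurable_cong]: "sets N = sets path_algebra"
  using canonical by (simp add: canonical_measure_def)

lemma space_N: "space N = measure_paths"
  using sets_eq_imp_space_eq[OF sets_N] by simp

lemma measurable_P: "P \<in> measurable finite_measure_algebra (prob_algebra path_algebra)"
  using laws by (simp add: super_brownian_laws_def)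

lemma P_prob:
  assumes "\<mu> \<in> finite_borel_measures"
  shows "prob_space (P \<mu>)" "sets (P \<mu>) = sets path_algebra" "space (P \<mu>) = measure_paths"
proof -
  have "P \<mu> \<in> space (prob_algebra path_algebra)"
    using measurable_space[OF measurable_P] assms by simp
  then show "prob_space (P \<mu>)" "sets (P \<mu>) = sets path_algebra"
    by (auto simp: space_prob_algebra)
  then show "space (P \<mu>) = measure_paths"
    using sets_eq_imp_space_eq[of "P \<mu>" path_algebra] by simp
qed

lemma space_path: "X \<in> measure_paths \<Longrightarrow> 0 \<le> t \<Longrightarrow> space (X t) = UNIV"
  by (rule finite_borel_measuresD[OF path_in_finite_borel_measures])

lemma measurable_mass: "0 \<le> t \<Longrightarrow> (\<lambda>X. emeasure (X t) UNIV) \<in> borel_measurable path_algebra"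
  by (rule measurable_compose[OF measurable_path_eval_algebra measurable_emeasure_UNIV])

lemma measurable_mass_real: "0 \<le> t \<Longrightarrow> (\<lambda>X. measure (X t) UNIV) \<in> borel_measurable path_algebra"
  by (rule measurable_compose[OF measurable_path_eval_algebra measurable_measure_open[OF open_UNIV]])

lemma emeasure_path: "X \<in> measure_paths \<Longrightarrow> 0 \<le> t \<Longrightarrow> emeasure (X t) A = ennreal (measure (X t) A)"
  by (rule emeasure_finite_borel_measure[OF path_in_finite_borel_measures])

lemma laplace_functional_N:
  "bounded_test_function f \<Longrightarrow> mild_solution f u \<Longrightarrow> 0 < t \<Longrightarrow>
    (\<integral>\<^sup>+X. ennreal (1 - exp (- (\<integral>x. f x \<partial>X t))) \<partial>N) = ennreal (u t 0)"
  using canonical unfolding canonical_measure_def by blast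

lemma laplace_functional_P:
  "\<mu> \<in> finite_borel_measures \<Longrightarrow> bounded_test_function f \<Longrightarrow> mild_solution f u \<Longrightarrow> 0 \<le> t \<Longrightarrow>
    (\<integral>X. exp (- (\<integral>x. f x \<partial>X t)) \<partial>P \<mu>) = exp (- (\<integral>x. u t x \<partial>\<mu>))"
  using laws unfolding super_brownian_laws_def by blast

text \<open>A constant test function turns the Laplace functional into the Laplace transform of the
  total mass.\<close>

lemma laplace_N:
  assumes "0 < t" "0 < l"
  shows "(\<integral>\<^sup>+X. ennreal (1 - exp (- (l * measure (X t) UNIV))) \<partial>N) = ennreal (2 * l / (2 + l * t))"
proof -
  have "(\<integral>\<^sup>+X. ennreal (1 - exp (- (\<integral>x. l \<partial>X t))) \<partial>N) = ennreal (2 * l / (2 + l * t))"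
    using laplace_functional_N[OF bounded_test_function_const mild_solution_const] assms by simp
  then show ?thesis
    using assms by (subst (asm) nn_integral_cong) (auto simp: space_N space_path)
qed

text \<open>The Laplace functional of \<open>P\<close> is a Bochner expectation of an integrand
  bounded by 1. Under a probability law its complement can be taken and rewritten as a nonnegative
  integral, the form required by \<open>laplace_mean\<close> and
  \<open>laplace_positive\<close>.\<close>

lemma laplace_P:
  assumes \<mu>: "\<mu> \<in> finite_borel_measures" and "0 < t" "0 < l"
  shows "(\<integral>\<^sup>+X. ennreal (1 - exp (- (l * measure (X t) UNIV))) \<partial>P \<mu>)
    = ennreal (1 - exp (- (2 * l / (2 + l * t) * measure \<mu> UNIV)))"
proof -
  note p = P_prob[OF \<mu>]
  interpret prob_space "P \<mu>" by (rule p)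
  have [measurable]: "(\<lambda>X. measure (X t) UNIV) \<in> borel_measurable (P \<mu>)"
    unfolding measurable_cong_sets[OF p(2) refl] by (rule measurable_mass_real) (use assms in simp)
  have *: "(\<integral>X. exp (- (\<integral>x. l \<partial>X t)) \<partial>P \<mu>) = exp (- (\<integral>x. 2 * l / (2 + l * t) \<partial>\<mu>))"
    using laplace_functional_P[OF \<mu> bounded_test_function_const mild_solution_const] assms by simp
  have "(\<integral>X. exp (- (\<integral>x. l \<partial>X t)) \<partial>P \<mu>) = (\<integral>X. exp (- (l * measure (X t) UNIV)) \<partial>P \<mu>)"
    using assms by (intro Bochner_Integration.integral_cong) (auto simp: p space_path)
  moreover have "(\<integral>x. 2 * l / (2 + l * t) \<partial>\<mu>) = 2 * l / (2 + l * t) * measure \<mu> UNIV"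
    by (simp add: finite_borel_measuresD[OF \<mu>])
  moreover have int: "integrable (P \<mu>) (\<lambda>X. exp (- (l * measure (X t) UNIV)))"
    using assms by (intro integrable_const_bound[of _ 1]) auto
  ultimately have "(\<integral>X. 1 - exp (- (l * measure (X t) UNIV)) \<partial>P \<mu>)
      = 1 - exp (- (2 * l / (2 + l * t) * measure \<mu> UNIV))"
    using * by (simp add: prob_space)
  then show ?thesis
    using int assms by (subst nn_integral_eq_integral) auto
qed

text \<open>The slope of \<open>2 * l / (2 + l * t)\<close> at \<open>l = 0\<close> is 1 for every
  \<open>t\<close>: branching is critical, so the mean mass does not change with time.\<close>

lemma mass_N:
  assumes "0 < t" shows "(\<integral>\<^sup>+X. emeasure (X t) UNIV \<partial>N) = 1"
proof -
  have "(\<integral>\<^sup>+X. ennreal (measure (X t) UNIV) \<partial>N) = ennreal 1"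
  proof (rule laplace_mean)
    show "(\<lambda>X. measure (X t) UNIV) \<in> borel_measurable N"
      unfolding measurable_cong_sets[OF sets_N refl] by (rule measurable_mass_real) (use assms in simp)
    show "((\<lambda>l. l * (2 * (1 / l) / (2 + 1 / l * t))) \<longlongrightarrow> 1) at_top"
      by real_asymp
  qed (use laplace_N assms in auto)
  moreover have "(\<integral>\<^sup>+X. emeasure (X t) UNIV \<partial>N) = (\<integral>\<^sup>+X. ennreal (measure (X t) UNIV) \<partial>N)"
    using assms by (intro nn_integral_cong) (auto simp: space_N emeasure_path)
  ultimately show ?thesis by simp
qed

text \<open>The value \<open>2 / t\<close> is the limit of \<open>2 * l / (2 + l * t)\<close> as
  \<open>l\<close> tends to infinity.\<close>

lemma survival_N:
  assumes "0 < t"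
  shows "(\<integral>\<^sup>+X. indicator {X. emeasure (X t) UNIV > 0} X \<partial>N) = ennreal (2 / t)"
proof -
  have "(\<integral>\<^sup>+X. indicator {X. 0 < measure (X t) UNIV} X \<partial>N) = ennreal (2 / t)"
  proof (rule laplace_positive)
    show "(\<lambda>X. measure (X t) UNIV) \<in> borel_measurable N"
      unfolding measurable_cong_sets[OF sets_N refl] by (rule measurable_mass_real) (use assms in simp)
    show "((\<lambda>l. 2 * l / (2 + l * t)) \<longlongrightarrow> 2 / t) at_top"
      using assms by (real_asymp simp: divide_inverse)
  qed (use laplace_N assms in auto)
  moreover have "(\<integral>\<^sup>+X. indicator {X. emeasure (X t) UNIV > 0} X \<partial>N)
      = (\<integral>\<^sup>+X. indicator {X. 0 < measure (X t) UNIV} X \<partial>N)"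
    using assms by (intro nn_integral_cong) (auto simp: space_N emeasure_path indicator_def)
  ultimately show ?thesis by simp
qed

text \<open>The slope of the transform at 0 is the initial mass. This is the source of the
  martingale property of the total mass and of the normalisation of the tilted kernels.\<close>

lemma mass_P:
  assumes \<mu>: "\<mu> \<in> finite_borel_measures" and t: "0 < t"
  shows "(\<integral>\<^sup>+X. emeasure (X t) UNIV \<partial>P \<mu>) = emeasure \<mu> UNIV"
proof -
  note p = P_prob[OF \<mu>]
  have "(\<integral>\<^sup>+X. ennreal (measure (X t) UNIV) \<partial>P \<mu>) = ennreal (measure \<mu> UNIV)"
  proof (rule laplace_mean)
    show "(\<lambda>X. measure (X t) UNIV) \<in> borel_measurable (P \<mu>)"
      unfolding measurable_cong_sets[OF p(2) refl] by (rule measurable_mass_real) (use t in simp)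
    show "((\<lambda>l. l * (1 - exp (- (2 * (1 / l) / (2 + 1 / l * t) * measure \<mu> UNIV)))) \<longlongrightarrow> measure \<mu> UNIV) at_top"
      by real_asymp
  qed (use laplace_P[OF \<mu> t] in auto)
  moreover have "(\<integral>\<^sup>+X. emeasure (X t) UNIV \<partial>P \<mu>) = (\<integral>\<^sup>+X. ennreal (measure (X t) UNIV) \<partial>P \<mu>)"
    using t by (intro nn_integral_cong) (auto simp: p emeasure_path)
  ultimately show ?thesis using \<mu> by (simp add: emeasure_finite_borel_measure)
qed

text \<open>In the limit of large \<open>l\<close> the exponent becomes the initial mass times
  \<open>2 / t\<close>, the survival rate per unit of initial mass.\<close>

lemma survival_P:
  assumes \<mu>: "\<mu> \<in> finite_borel_measures" and t: "0 < t"
  shows "(\<integral>\<^sup>+X. indicator {X. emeasure (X t) UNIV > 0} X \<partial>P \<mu>)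
    = ennreal (1 - exp (- (2 * measure \<mu> UNIV / t)))"
proof -
  note p = P_prob[OF \<mu>]
  have "(\<integral>\<^sup>+X. indicator {X. 0 < measure (X t) UNIV} X \<partial>P \<mu>) = ennreal (1 - exp (- (2 * measure \<mu> UNIV / t)))"
  proof (rule laplace_positive)
    show "(\<lambda>X. measure (X t) UNIV) \<in> borel_measurable (P \<mu>)"
      unfolding measurable_cong_sets[OF p(2) refl] by (rule measurable_mass_real) (use t in simp)
    have "((\<lambda>l. 2 * l / (2 + l * t)) \<longlongrightarrow> 2 / t) at_top"
      using t by (real_asymp simp: divide_inverse)
    then have "((\<lambda>l. 1 - exp (- (2 * l / (2 + l * t) * measure \<mu> UNIV)))
        \<longlongrightarrow> 1 - exp (- (2 / t * measure \<mu> UNIV))) at_top"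
      by (intro tendsto_diff tendsto_exp tendsto_minus tendsto_mult_right tendsto_const)
    then show "((\<lambda>l. 1 - exp (- (2 * l / (2 + l * t) * measure \<mu> UNIV)))
        \<longlongrightarrow> 1 - exp (- (2 * measure \<mu> UNIV / t))) at_top"
      by simp
  qed (use laplace_P[OF \<mu> t] in auto)
  moreover have "(\<integral>\<^sup>+X. indicator {X. emeasure (X t) UNIV > 0} X \<partial>P \<mu>)
      = (\<integral>\<^sup>+X. indicator {X. 0 < measure (X t) UNIV} X \<partial>P \<mu>)"
    using t by (intro nn_integral_cong) (auto simp: p emeasure_path indicator_def)
  ultimately show ?thesis by simp
qed

lemma measurable_P_eval:
  assumes "0 \<le> s"
  shows "(\<lambda>X. P (X s)) \<in> measurable path_algebra (subprob_algebra path_algebra)"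
  by (rule measurable_compose[OF measurable_path_eval_algebra[OF assms]])
     (rule measurable_prob_algebraD[OF measurable_P])

text \<open>The defining Markov property concerns events \<open>G\<close> of the shifted path. For a
  fixed \<open>E\<close> it says that two measures on path space coincide, and integrating
  \<open>g\<close> against both gives the functional form.\<close>

lemma markov_N:
  assumes s: "0 < s" and E: "E \<in> sets (path_filtration s)"
    and g[measurable]: "g \<in> borel_measurable path_algebra"
  shows "(\<integral>\<^sup>+X. indicator E X * g (shift_path s X) \<partial>N)
    = (\<integral>\<^sup>+X. indicator E X * (\<integral>\<^sup>+Y. g Y \<partial>P (X s)) \<partial>N)"
proof -
  have s0: "0 \<le> s" using s by simp
  have EN: "E \<in> sets N"
    using E path_filtration_le_path_algebra[OF s0] sets_N by auto
  \<comment> \<open>Restricting \<open>N\<close> to \<open>E\<close> absorbs the indicator: one side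
    becomes a push-forward under the shift, the other a mixture of the laws
    \<open>P (X s)\<close>.\<close>
  define D where "D = density N (indicator E)"
  have sD: "sets D = sets path_algebra" by (simp add: D_def sets_N)
  note mD = measurable_cong_sets[OF sD refl]
  have shD: "shift_path s \<in> measurable D path_algebra"
    unfolding mD by (rule measurable_shift_path_algebra[OF s0])
  have kD: "(\<lambda>X. P (X s)) \<in> measurable D (subprob_algebra path_algebra)"
    unfolding mD by (rule measurable_P_eval[OF s0])
  have spD: "space D = measure_paths" using sets_eq_imp_space_eq[OF sD] by simp
  \<comment> \<open>On an empty space \<open>bind\<close> takes a default value, so nonemptiness has
    to be known.\<close>
  have ne: "space D \<noteq> {}" using constant_null_path by (auto simp: spD)
  have eq: "distr D path_algebra (shift_path s) = D \<bind> (\<lambda>X. P (X s))"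
  proof (rule measure_eqI)
    show "sets (distr D path_algebra (shift_path s)) = sets (D \<bind> (\<lambda>X. P (X s)))"
      by (subst sets_bind[where N=path_algebra, OF _ ne]) (simp_all add: subprob_measurableD(2)[OF kD])
    fix G assume "G \<in> sets (distr D path_algebra (shift_path s))"
    then have G: "G \<in> sets path_algebra" by simp
    have pre: "shift_path s -` G \<inter> space D \<in> sets N"
      using measurable_sets[OF shD G] by (simp add: D_def)
    have EP: "E \<subseteq> measure_paths" using sets.sets_into_space[OF E] by simp
    have "emeasure (distr D path_algebra (shift_path s)) G = emeasure D (shift_path s -` G \<inter> space D)"
      by (rule emeasure_distr[OF shD G])
    also have "\<dots> = emeasure N (E \<inter> (shift_path s -` G \<inter> space D))"
    proof -
      have "emeasure D (shift_path s -` G \<inter> space D)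
          = (\<integral>\<^sup>+X. indicator E X * indicator (shift_path s -` G \<inter> space D) X \<partial>N)"
        unfolding D_def by (rule emeasure_density) (use EN pre in \<open>auto simp: D_def\<close>)
      also have "\<dots> = (\<integral>\<^sup>+X. indicator (E \<inter> (shift_path s -` G \<inter> space D)) X \<partial>N)"
        by (simp only: indicator_inter_arith)
      also have "\<dots> = emeasure N (E \<inter> (shift_path s -` G \<inter> space D))"
        using EN pre by (intro nn_integral_indicator) auto
      finally show ?thesis .
    qed
    also have "E \<inter> (shift_path s -` G \<inter> space D) = {X \<in> E. shift_path s X \<in> G}"
      using EP by (auto simp: spD)
    also have "emeasure N {X \<in> E. shift_path s X \<in> G} = (\<integral>\<^sup>+X. indicator E X * emeasure (P (X s)) G \<partial>N)"
      using canonical s E G unfolding canonical_measure_def by blast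
    also have "\<dots> = (\<integral>\<^sup>+X. emeasure (P (X s)) G \<partial>D)"
      using measurable_emeasure_kernel[OF kD G] EN
      by (simp add: D_def nn_integral_density)
    also have "\<dots> = emeasure (D \<bind> (\<lambda>X. P (X s))) G"
      by (rule emeasure_bind[OF ne kD G, symmetric])
    finally show "emeasure (distr D path_algebra (shift_path s)) G = emeasure (D \<bind> (\<lambda>X. P (X s))) G" .
  qed
  have gm: "(\<lambda>X. g (shift_path s X)) \<in> borel_measurable D"
    by (rule measurable_compose[OF shD g])
  have Pm: "(\<lambda>X. \<integral>\<^sup>+Y. g Y \<partial>P (X s)) \<in> borel_measurable D"
    by (rule measurable_compose[OF kD nn_integral_measurable_subprob_algebra[OF g]])
  have "(\<integral>\<^sup>+X. indicator E X * g (shift_path s X) \<partial>N) = (\<integral>\<^sup>+X. g (shift_path s X) \<partial>D)"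
    using gm EN unfolding D_def by (subst nn_integral_density) auto
  also have "\<dots> = (\<integral>\<^sup>+X. g X \<partial>distr D path_algebra (shift_path s))"
    by (subst nn_integral_distr[OF shD]) simp_all
  also have "\<dots> = (\<integral>\<^sup>+X. \<integral>\<^sup>+Y. g Y \<partial>P (X s) \<partial>D)"
    unfolding eq by (rule nn_integral_bind[OF g kD])
  also have "\<dots> = (\<integral>\<^sup>+X. indicator E X * (\<integral>\<^sup>+Y. g Y \<partial>P (X s)) \<partial>N)"
    using Pm EN unfolding D_def by (subst nn_integral_density) auto
  finally show ?thesis .
qed

end

subsection \<open>Gluing unit-time pieces\<close>

definition compatible :: "(nat \<Rightarrow> real \<Rightarrow> 'a measure) \<Rightarrow> bool" where
  "compatible \<omega> \<longleftrightarrow> (\<forall>k. \<omega> (Suc k) 0 = \<omega> k 1)"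

text \<open>At an integer time the value is the initial value of the later piece; for compatible
  sequences it equals the final value of the earlier one.\<close>

definition glue :: "(nat \<Rightarrow> real \<Rightarrow> 'a measure) \<Rightarrow> real \<Rightarrow> 'a measure" where
  "glue \<omega> = (\<lambda>t\<in>{0..}. \<omega> (nat \<lfloor>t\<rfloor>) (t - real (nat \<lfloor>t\<rfloor>)))"

lemma glue_eq:
  assumes c: "compatible \<omega>" and t: "real k \<le> t" "t \<le> real k + 1"
  shows "glue \<omega> t = \<omega> k (t - real k)"
proof (cases "t = real k + 1")
  case True
  have "nat \<lfloor>t\<rfloor> = Suc k" using True by linarith
  then show ?thesis using c True by (simp add: glue_def compatible_def)
next
  case False
  have "nat \<lfloor>t\<rfloor> = k" using False t by linarith
  then show ?thesis using t by (simp add: glue_def)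
qed

text \<open>The closed intervals \<open>{k..k + 1}\<close> form a locally finite cover of the
  half-line, and compatibility makes the shifted pieces agree on overlaps, so the pasting lemma
  gives continuity.\<close>

lemma glue_in_measure_paths:
  fixes \<omega> :: "nat \<Rightarrow> real \<Rightarrow> 'a::euclidean_space measure"
  assumes \<omega>: "\<And>k. \<omega> k \<in> measure_paths" and c: "compatible \<omega>"
  shows "glue \<omega> \<in> measure_paths"
proof -
  let ?T = "\<lambda>k::nat. {real k..real k + 1}"
  have "continuous_map (top_of_set {0..}) weak_topology (glue \<omega>)"
  proof (rule pasting_lemma_locally_finite[where I=UNIV and T="?T" and f="\<lambda>k t. \<omega> k (t - real k)"])
    fix x :: real assume "x \<in> topspace (top_of_set {0..})"
    then have x: "0 \<le> x" by simp
    \<comment> \<open>Every interval of the cover that meets this window starts before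
      \<open>x + 1\<close>, so there are only finitely many.\<close>
    let ?V = "{0..} \<inter> {x - 1<..<x + 1}"
    have "{k \<in> UNIV. ?T k \<inter> ?V \<noteq> {}} \<subseteq> {..nat \<lceil>x\<rceil> + 1}"
    proof
      fix k assume "k \<in> {k \<in> UNIV. ?T k \<inter> ?V \<noteq> {}}"
      then have "real k < x + 1" by auto
      then show "k \<in> {..nat \<lceil>x\<rceil> + 1}" by simp linarith
    qed
    then have "finite {k \<in> UNIV. ?T k \<inter> ?V \<noteq> {}}" by (rule finite_subset) simp
    moreover have "openin (top_of_set {0..}) ?V" by (rule openin_open_Int) simp
    ultimately show "\<exists>V. openin (top_of_set {0..}) V \<and> x \<in> V \<and> finite {k \<in> UNIV. ?T k \<inter> V \<noteq> {}}"
      using x by (intro exI[of _ ?V]) auto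
    show "\<exists>k. k \<in> UNIV \<and> x \<in> ?T k \<and> glue \<omega> x = \<omega> k (x - real k)"
    proof (intro exI conjI)
      show "x \<in> ?T (nat \<lfloor>x\<rfloor>)" using x by auto
      then show "glue \<omega> x = \<omega> (nat \<lfloor>x\<rfloor>) (x - real (nat \<lfloor>x\<rfloor>))"
        by (intro glue_eq[OF c]) auto
    qed simp
  next
    fix k
    have "?T k = {0..} \<inter> ?T k" by auto
    then show "closedin (top_of_set {0..}) (?T k)"
      by (metis closed_atLeastAtMost closedin_closed_Int)
    have "continuous_map (top_of_set (?T k)) (top_of_set {0..}) (\<lambda>t. t - real k)"
      by (auto intro!: continuous_intros)
    then have "continuous_map (top_of_set (?T k)) weak_topology (\<omega> k \<circ> (\<lambda>t. t - real k))"
      by (rule continuous_map_compose) (use \<omega>[of k] in \<open>simp add: measure_paths_def\<close>)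
    moreover have "{0..} \<inter> ?T k = ?T k" by auto
    ultimately show "continuous_map (subtopology (top_of_set {0..}) (?T k)) weak_topology (\<lambda>t. \<omega> k (t - real k))"
      by (simp add: subtopology_subtopology comp_def)
  next
    fix i j x assume "x \<in> topspace (top_of_set {0..}) \<inter> ?T i \<inter> ?T j"
    then show "\<omega> i (x - real i) = \<omega> j (x - real j)"
      using glue_eq[OF c, of i x] glue_eq[OF c, of j x] by simp
  qed
  then show ?thesis by (simp add: measure_paths_def glue_def)
qed

lemma compatible_shift_path: "compatible (\<lambda>k. shift_path (real k) X)"
  by (simp add: compatible_def shift_path_def ac_simps)

text \<open>Cutting a genuine path into its shifts loses nothing. This identifies events of the path
  with events of its sequence of pieces.\<close>

lemma glue_shift_path:
  assumes "X \<in> measure_paths"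
  shows "glue (\<lambda>k. shift_path (real k) X) = X"
proof -
  have X: "X \<in> extensional {0..}" using assms by (simp add: measure_paths_def)
  have "shift_path (real (nat \<lfloor>t\<rfloor>)) X (t - real (nat \<lfloor>t\<rfloor>)) = X t" if "0 \<le> t" for t
  proof -
    have "0 \<le> t - real (nat \<lfloor>t\<rfloor>)" using that by linarith
    then show ?thesis by (simp add: shift_path_def)
  qed
  then show ?thesis
    using X by (auto simp: glue_def extensional_def fun_eq_iff)
qed

text \<open>A piece is formally a path on the whole half-line, but the \<sigma>-algebra sees only
  its values on \<open>{0..1}\<close>. What it does after time 1 is ignored, and no separate space
  of paths on a compact interval is introduced.\<close>

abbreviation unit_paths :: "(real \<Rightarrow> 'a::euclidean_space measure) measure" where
  "unit_paths \<equiv> path_filtration 1"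

lemma space_PiM_paths: "space (PiM UNIV (\<lambda>_. unit_paths)) = (UNIV \<rightarrow> measure_paths)"
  by (simp add: space_PiM PiE_UNIV_domain)

lemma measure_paths_in_unit_paths: "measure_paths \<in> sets unit_paths"
  using sets.top[of unit_paths] by simp

lemma measurable_piece_eval:
  assumes "k \<in> I" "0 \<le> r" "r \<le> 1"
  shows "(\<lambda>\<omega>. \<omega> k r) \<in> measurable (PiM I (\<lambda>_. unit_paths)) finite_measure_algebra"
  by (rule measurable_compose[OF measurable_component_singleton[OF assms(1)] measurable_path_eval[OF assms(2,3)]])

text \<open>Up to time \<open>n\<close> the glued path is determined by the first \<open>n\<close>
  pieces. The property passes through the generation of the \<sigma>-algebra, with \<open>B\<close>
  independent of the sequence; it is asserted on compatible sequences only, which later have full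
  measure.\<close>

lemma glue_cylinder:
  fixes E :: "(real \<Rightarrow> 'a::euclidean_space measure) set"
  assumes n: "1 \<le> n" and E: "E \<in> sets (path_filtration (real n))"
  shows "\<exists>B. B \<in> sets (PiM {0..<n} (\<lambda>_. unit_paths)) \<and>
    (\<forall>\<omega>. (\<forall>k. \<omega> k \<in> measure_paths) \<longrightarrow> compatible \<omega> \<longrightarrow> (glue \<omega> \<in> E \<longleftrightarrow> restrict \<omega> {0..<n} \<in> B))"
    (is "\<exists>B. ?cyl E B")
  using E unfolding sets_path_filtration
proof (induction E rule: sigma_sets.induct)
  case (Basic Y)
  then obtain r A where Y: "Y = {X \<in> measure_paths. X r \<in> A}"
    and r: "0 \<le> r" "r \<le> real n" and A: "A \<in> sets finite_measure_algebra"
    by auto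
  \<comment> \<open>At \<open>r = real n\<close> the floor would select piece \<open>n\<close>,
    which is not among the first \<open>n\<close>; the final value of piece \<open>n - 1\<close> is
    used instead.\<close>
  obtain k where k: "k < n" "real k \<le> r" "r \<le> real k + 1"
  proof (cases "r = real n")
    case True
    then show ?thesis using n by (intro that[of "n - 1"]) (auto simp: of_nat_diff)
  next
    case False
    then have "nat \<lfloor>r\<rfloor> < n" "real (nat \<lfloor>r\<rfloor>) \<le> r" "r \<le> real (nat \<lfloor>r\<rfloor>) + 1"
      using r by linarith+
    then show ?thesis by (rule that)
  qed
  let ?B = "(\<lambda>\<omega>. \<omega> k (r - real k)) -` A \<inter> space (PiM {0..<n} (\<lambda>_. unit_paths))"
  have "(\<lambda>\<omega>. \<omega> k (r - real k)) \<in> measurable (PiM {0..<n} (\<lambda>_. unit_paths)) finite_measure_algebra"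
    using k by (intro measurable_piece_eval) auto
  then have "?B \<in> sets (PiM {0..<n} (\<lambda>_. unit_paths))"
    using A by (rule measurable_sets)
  moreover have "glue \<omega> \<in> Y \<longleftrightarrow> restrict \<omega> {0..<n} \<in> ?B"
    if "\<forall>k. \<omega> k \<in> measure_paths" "compatible \<omega>" for \<omega>
    using that glue_in_measure_paths[of \<omega>] glue_eq[OF that(2) k(2,3)] k(1)
    by (auto simp: Y space_PiM)
  ultimately show ?case by blast
next
  case Empty
  show ?case by (intro exI[of _ "{}"]) auto
next
  case (Compl Y)
  obtain B where B: "B \<in> sets (PiM {0..<n} (\<lambda>_. unit_paths))"
    and eq: "\<And>\<omega>. (\<forall>k. \<omega> k \<in> measure_paths) \<Longrightarrow> compatible \<omega> \<Longrightarrow> (glue \<omega> \<in> Y \<longleftrightarrow> restrict \<omega> {0..<n} \<in> B)"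
    using Compl.IH by blast
  show ?case
  proof (intro exI conjI allI impI)
    show "space (PiM {0..<n} (\<lambda>_. unit_paths)) - B \<in> sets (PiM {0..<n} (\<lambda>_. unit_paths))"
      using B by auto
    fix \<omega> :: "nat \<Rightarrow> real \<Rightarrow> 'a measure"
    assume "\<forall>k. \<omega> k \<in> measure_paths" "compatible \<omega>"
    then show "glue \<omega> \<in> measure_paths - Y \<longleftrightarrow> restrict \<omega> {0..<n} \<in> space (PiM {0..<n} (\<lambda>_. unit_paths)) - B"
      using eq[of \<omega>] glue_in_measure_paths[of \<omega>] by (auto simp: space_PiM)
  qed
next
  case (Union Y)
  have "\<forall>i. \<exists>B. ?cyl (Y i) B" using Union.IH by (rule allI)
  from choice[OF this] obtain B where B: "\<forall>i. ?cyl (Y i) (B i)" ..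
  then have "(\<Union>i. B i) \<in> sets (PiM {0..<n} (\<lambda>_. unit_paths))" by auto
  then show ?case
    using B by (intro exI[of _ "\<Union>i. B i"] conjI allI impI) (simp_all del: restrict_apply)
qed

subsection \<open>The chain of tilted pieces and its limit law\<close>

context super_brownian_motion
begin

text \<open>At the zero measure the tilt \<open>0 / 0\<close> is replaced by \<open>1\<close>, so that \<open>step_kernel\<close> below is a
  probability kernel everywhere.\<close>
definition tilt :: "'a measure \<Rightarrow> (real \<Rightarrow> 'a measure) \<Rightarrow> ennreal" where
  "tilt \<mu> X = (if emeasure \<mu> UNIV = 0 then 1 else emeasure (X 1) UNIV / emeasure \<mu> UNIV)"

text \<open>This is the Doob transform of \<open>P\<close> by the total mass over one unit of time.
  The push-forward under the identity only coarsens the \<sigma>-algebra to that of the first time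
  unit.\<close>

definition step_kernel :: "'a measure \<Rightarrow> (real \<Rightarrow> 'a measure) measure" where
  "step_kernel \<mu> = distr (density (P \<mu>) (tilt \<mu>)) unit_paths (\<lambda>X. X)"

lemma sets_step_kernel: "sets (step_kernel \<mu>) = sets unit_paths"
  by (simp add: step_kernel_def)

lemma measurable_tilt: "tilt \<mu> \<in> borel_measurable path_algebra"
  unfolding tilt_def[abs_def] using measurable_mass[of 1] by measurable

lemma emeasure_step_kernel:
  assumes \<mu>: "\<mu> \<in> finite_borel_measures" and G: "G \<in> sets unit_paths"
  shows "emeasure (step_kernel \<mu>) G = (\<integral>\<^sup>+X. tilt \<mu> X * indicator G X \<partial>P \<mu>)"
proof -
  note p = P_prob[OF \<mu>]
  have GP: "G \<in> sets (P \<mu>)"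
    using G path_filtration_le_path_algebra[of 1] by (auto simp: p)
  have "(\<lambda>X. X) \<in> measurable (density (P \<mu>) (tilt \<mu>)) unit_paths"
    using measurable_path_algebraI[of 1 "\<lambda>X. X" unit_paths]
    by (simp add: measurable_cong_sets[OF p(2) refl])
  then have "emeasure (step_kernel \<mu>) G = emeasure (density (P \<mu>) (tilt \<mu>)) G"
    unfolding step_kernel_def using sets.sets_into_space[OF G]
    by (subst emeasure_distr[OF _ G]) (auto simp: p Int_absorb2)
  also have "\<dots> = (\<integral>\<^sup>+X. tilt \<mu> X * indicator G X \<partial>P \<mu>)"
    using GP measurable_tilt by (intro emeasure_density) (simp_all add: measurable_cong_sets[OF p(2) refl])
  finally show ?thesis .
qed

lemma emeasure_finite_borel_neq_top: "\<mu> \<in> finite_borel_measures \<Longrightarrow> emeasure \<mu> A \<noteq> \<infinity>"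
  by (simp add: emeasure_finite_borel_measure)

text \<open>Multiplying out the denominator of the tilt gives a formula that also holds at measures
  of mass 0, where \<open>mass_P\<close> makes both sides vanish. In this form the tilts telescope
  along the chain.\<close>

lemma step_kernel_mass:
  assumes \<mu>: "\<mu> \<in> finite_borel_measures" and G: "G \<in> sets unit_paths"
  shows "emeasure \<mu> UNIV * emeasure (step_kernel \<mu>) G
    = (\<integral>\<^sup>+X. emeasure (X 1) UNIV * indicator G X \<partial>P \<mu>)"
proof -
  note p = P_prob[OF \<mu>]
  have GP: "G \<in> sets (P \<mu>)"
    using G path_filtration_le_path_algebra[of 1] by (auto simp: p)
  show ?thesis
  proof (cases "emeasure \<mu> UNIV = 0")
    case True
    have "(\<integral>\<^sup>+X. emeasure (X 1) UNIV * indicator G X \<partial>P \<mu>) \<le> (\<integral>\<^sup>+X. emeasure (X 1) UNIV \<partial>P \<mu>)"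
      by (intro nn_integral_mono) (auto simp: indicator_def)
    then show ?thesis using True mass_P[OF \<mu>, of 1] by simp
  next
    case False
    have m: "(\<lambda>X. tilt \<mu> X * indicator G X) \<in> borel_measurable (P \<mu>)"
      using GP measurable_tilt[of \<mu>] unfolding measurable_cong_sets[OF p(2) refl] p(2)
      by (intro borel_measurable_times_ennreal borel_measurable_indicator)
    have "emeasure \<mu> UNIV * tilt \<mu> X = emeasure (X 1) UNIV" for X
      using False emeasure_finite_borel_neq_top[OF \<mu>, of UNIV]
      by (simp add: tilt_def ennreal_times_divide ennreal_mult_divide_eq mult.commute[of "emeasure \<mu> UNIV"])
    then show ?thesis
      unfolding emeasure_step_kernel[OF assms] nn_integral_cmult[OF m, symmetric]
      by (simp add: mult.assoc[symmetric])
  qed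
qed

lemma prob_space_step_kernel:
  assumes \<mu>: "\<mu> \<in> finite_borel_measures"
  shows "prob_space (step_kernel \<mu>)"
proof
  note p = P_prob[OF \<mu>]
  have sp: "space (step_kernel \<mu>) = measure_paths" by (simp add: step_kernel_def)
  note top = measure_paths_in_unit_paths
  have ind: "(\<integral>\<^sup>+X. f X * indicator measure_paths X \<partial>P \<mu>) = (\<integral>\<^sup>+X. f X \<partial>P \<mu>)" for f
    by (intro nn_integral_cong) (simp add: p)
  show "emeasure (step_kernel \<mu>) (space (step_kernel \<mu>)) = 1"
  proof (cases "emeasure \<mu> UNIV = 0")
    case True
    then show ?thesis
      using prob_space.emeasure_space_1[OF p(1)]
      unfolding sp emeasure_step_kernel[OF \<mu> top] ind by (simp add: tilt_def)
  next
    case False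
    have "emeasure \<mu> UNIV * emeasure (step_kernel \<mu>) measure_paths = emeasure \<mu> UNIV * 1"
      using mass_P[OF \<mu>, of 1] by (simp add: step_kernel_mass[OF \<mu> top] ind)
    then show ?thesis
      using False emeasure_finite_borel_neq_top[OF \<mu>, of UNIV]
      unfolding sp ennreal_mult_cancel_left by auto
  qed
qed

text \<open>The density depends on \<mu>. Once the mass of \<mu> is divided out, a fixed function is
  integrated against \<open>P \<mu>\<close>, and measurability of the kernel \<open>P\<close>
  applies.\<close>

lemma measurable_step_kernel: "step_kernel \<in> measurable finite_measure_algebra (subprob_algebra unit_paths)"
proof (rule measurable_subprob_algebra)
  fix G :: "(real \<Rightarrow> 'a measure) set" assume G: "G \<in> sets unit_paths"
  then have Gp: "G \<in> sets path_algebra"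
    using path_filtration_le_path_algebra[of 1] by auto
  have [measurable]: "P \<in> measurable finite_measure_algebra (subprob_algebra path_algebra)"
    by (rule measurable_prob_algebraD[OF measurable_P])
  have [measurable]: "(\<lambda>X. emeasure (X 1) UNIV * indicator G X) \<in> borel_measurable path_algebra"
    using measurable_mass[of 1] Gp by measurable
  have "(\<lambda>\<mu>. if emeasure \<mu> UNIV = 0 then emeasure (P \<mu>) G
      else (\<integral>\<^sup>+X. emeasure (X 1) UNIV * indicator G X \<partial>P \<mu>) / emeasure \<mu> UNIV)
      \<in> borel_measurable finite_measure_algebra"
    using Gp by measurable
  moreover have "emeasure (step_kernel \<mu>) G = (if emeasure \<mu> UNIV = 0 then emeasure (P \<mu>) G
      else (\<integral>\<^sup>+X. emeasure (X 1) UNIV * indicator G X \<partial>P \<mu>) / emeasure \<mu> UNIV)"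
    if "\<mu> \<in> space finite_measure_algebra" for \<mu>
  proof -
    have \<mu>: "\<mu> \<in> finite_borel_measures" using that by simp
    note p = P_prob[OF \<mu>]
    show ?thesis
    proof (cases "emeasure \<mu> UNIV = 0")
      case True
      then show ?thesis using Gp by (simp add: emeasure_step_kernel[OF \<mu> G] tilt_def p)
    next
      case False
      then show ?thesis
        using emeasure_finite_borel_neq_top[OF \<mu>, of UNIV]
        by (simp add: step_kernel_mass[OF \<mu> G, symmetric] mult.commute[of "emeasure \<mu> UNIV"]
            ennreal_mult_divide_eq)
    qed
  qed
  ultimately show "(\<lambda>\<mu>. emeasure (step_kernel \<mu>) G) \<in> borel_measurable finite_measure_algebra"
    by (subst measurable_cong) auto
qed (auto simp: sets_step_kernel prob_space_imp_subprob_space prob_space_step_kernel)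

section \<open>Mass-biased laws at integer times and the chain of pieces\<close>

definition biased :: "nat \<Rightarrow> (real \<Rightarrow> 'a measure) measure" where
  "biased n = density N (\<lambda>X. emeasure (X (real n)) UNIV)"

lemma sets_biased: "sets (biased n) = sets path_algebra"
  by (simp add: biased_def sets_N)

lemma space_biased: "space (biased n) = measure_paths"
  by (simp add: biased_def space_N)

lemma nn_integral_biased:
  assumes "f \<in> borel_measurable path_algebra"
  shows "(\<integral>\<^sup>+X. f X \<partial>biased n) = (\<integral>\<^sup>+X. emeasure (X (real n)) UNIV * f X \<partial>N)"
  unfolding biased_def using assms measurable_mass[of "real n"]
  by (intro nn_integral_density) (simp_all add: measurable_cong_sets[OF sets_N refl])

lemma emeasure_biased:
  assumes "A \<in> sets path_algebra"
  shows "emeasure (biased n) A = (\<integral>\<^sup>+X. emeasure (X (real n)) UNIV * indicator A X \<partial>N)"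
  using nn_integral_biased[of "indicator A" n] assms by (simp add: sets_biased)

lemma prob_space_biased:
  assumes "1 \<le> n" shows "prob_space (biased n)"
proof
  have top: "measure_paths \<in> sets (path_algebra :: (real \<Rightarrow> 'a measure) measure)"
    using sets.top[of "path_algebra :: (real \<Rightarrow> 'a measure) measure"] by simp
  have "emeasure (biased n) (space (biased n)) = (\<integral>\<^sup>+X. emeasure (X (real n)) UNIV \<partial>N)"
    unfolding space_biased emeasure_biased[OF top] by (intro nn_integral_cong) (simp add: space_N)
  then show "emeasure (biased n) (space (biased n)) = 1"
    using assms by (simp add: mass_N)
qed

text \<open>Under \<open>N\<close> paths start at the zero measure, so biasing by the mass at time 0
  would give nothing; the first piece is therefore drawn from \<open>biased 1\<close>. Each later
  piece depends on the past only through the value of its predecessor at time 1.\<close>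

definition chain :: "nat \<Rightarrow> (nat \<Rightarrow> real \<Rightarrow> 'a measure) \<Rightarrow> (real \<Rightarrow> 'a measure) measure" where
  "chain n \<omega> = (case n of 0 \<Rightarrow> distr (biased 1) unit_paths (\<lambda>X. X) | Suc k \<Rightarrow> step_kernel (\<omega> k 1))"

lemma measurable_id_unit_paths: "(\<lambda>X. X) \<in> measurable (biased n) unit_paths"
  using measurable_path_algebraI[of 1 "\<lambda>X. X" unit_paths]
  by (simp add: measurable_cong_sets[OF sets_biased refl])

lemma chain_eval:
  fixes \<omega> :: "nat \<Rightarrow> real \<Rightarrow> 'a measure"
  assumes "\<omega> \<in> space (PiM {0..<n} (\<lambda>_. unit_paths))" "k < n"
  shows "\<omega> k 1 \<in> finite_borel_measures"
proof -
  have "\<omega> k \<in> measure_paths"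
    by (rule PiE_mem[where S="{0..<n}"]) (use assms in \<open>simp_all add: space_PiM\<close>)
  then show ?thesis by (simp add: path_in_finite_borel_measures)
qed

lemma prob_space_chain_start: "prob_space (distr (biased 1) unit_paths (\<lambda>X. X))"
  by (intro prob_space.prob_space_distr prob_space_biased measurable_id_unit_paths) simp

lemma measurable_chain:
  "chain n \<in> measurable (PiM {0..<n} (\<lambda>_. unit_paths)) (subprob_algebra unit_paths)"
proof (cases n)
  case 0
  then show ?thesis
    using prob_space_chain_start
    by (simp add: chain_def[abs_def] space_subprob_algebra prob_space_imp_subprob_space)
next
  case (Suc k)
  have "(\<lambda>\<omega>. \<omega> k 1) \<in> measurable (PiM {0..<n} (\<lambda>_. unit_paths)) finite_measure_algebra"
    using Suc by (intro measurable_piece_eval) auto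
  then show ?thesis
    using Suc measurable_compose[OF _ measurable_step_kernel] by (simp add: chain_def[abs_def])
qed

lemma prob_space_chain:
  "\<omega> \<in> space (PiM {0..<n} (\<lambda>_. unit_paths)) \<Longrightarrow> prob_space (chain n \<omega>)"
  using prob_space_chain_start chain_eval[of \<omega> n]
  by (cases n) (auto simp: chain_def prob_space_step_kernel)

text \<open>Here \<open>IT.C 0 n\<close> is the joint law of the first \<open>n\<close> pieces, and
  \<open>IT.PF.lim\<close> is the law of the infinite sequence.\<close>

sublocale IT: Ionescu_Tulcea chain "\<lambda>_. unit_paths"
  by (rule Ionescu_Tulcea.intro) (rule measurable_chain, rule prob_space_chain)

definition pieces :: "nat \<Rightarrow> (real \<Rightarrow> 'a measure) \<Rightarrow> nat \<Rightarrow> real \<Rightarrow> 'a measure" where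
  "pieces n X = (\<lambda>k\<in>{0..<n}. shift_path (real k) X)"

lemma measurable_pieces_filtration:
  "pieces n \<in> measurable (path_filtration (real n)) (PiM {0..<n} (\<lambda>_. unit_paths))"
  unfolding pieces_def[abs_def]
proof (rule measurable_restrict)
  fix k assume "k \<in> {0..<n}"
  then show "shift_path (real k) \<in> measurable (path_filtration (real n)) unit_paths"
    by (intro measurable_path_filtration_mono[OF _ measurable_shift_path]) auto
qed

lemma measurable_pieces: "pieces n \<in> measurable path_algebra (PiM {0..<n} (\<lambda>_. unit_paths))"
  by (rule measurable_path_algebraI[OF _ measurable_pieces_filtration]) simp

text \<open>By induction on \<open>n\<close>: appending a piece multiplies the weight by the ratio
  of final to initial mass, and the initial mass cancels the weight already present in
  \<open>biased n\<close>. The Markov property at time \<open>n\<close> then joins the old path and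
  the new piece into one path under \<open>N\<close>.\<close>

lemma pieces_law:
  assumes "1 \<le> n"
  shows "IT.C 0 n (\<lambda>_. undefined) = distr (biased n) (PiM {0..<n} (\<lambda>_. unit_paths)) (pieces n)"
  using assms
proof (induction n rule: nat_induct_at_least)
  case base
  let ?u = "\<lambda>_::nat. undefined :: real \<Rightarrow> 'a measure"
  have u: "?u \<in> space (PiM {0..<0} (\<lambda>_. unit_paths))" by (simp add: space_PiM)
  have "IT.C 0 1 ?u = IT.eP 0 ?u"
    using bind_return[OF IT.measurable_eP[of 0] u] by simp
  also have "\<dots> = distr (distr (biased 1) unit_paths (\<lambda>X. X)) (PiM {0..<1} (\<lambda>_. unit_paths)) (fun_upd ?u 0)"
    by (simp add: IT.eP_def chain_def)
  also have "\<dots> = distr (biased 1) (PiM {0..<1} (\<lambda>_. unit_paths)) (fun_upd ?u 0 \<circ> (\<lambda>X. X))"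
  proof (rule distr_distr[OF _ measurable_id_unit_paths])
    show "fun_upd ?u 0 \<in> measurable unit_paths (PiM {0..<1} (\<lambda>_. unit_paths))"
      using u by (intro measurable_fun_upd[where J="{0..<0}"]) auto
  qed
  also have "\<dots> = distr (biased 1) (PiM {0..<1} (\<lambda>_. unit_paths)) (pieces 1)"
  proof (rule distr_cong)
    fix X assume "X \<in> space (biased 1)"
    then have "shift_path 0 X = X"
      by (auto simp: space_biased measure_paths_def shift_path_def extensional_def fun_eq_iff)
    then show "(fun_upd ?u 0 \<circ> (\<lambda>X. X)) X = pieces 1 X"
      by (auto simp: pieces_def fun_eq_iff restrict_def)
  qed simp_all
  finally show ?case .
next
  case (Suc n)
  let ?u = "\<lambda>_::nat. undefined :: real \<Rightarrow> 'a measure"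
  let ?PM = "\<lambda>n. PiM {0..<n} (\<lambda>_. unit_paths :: (real \<Rightarrow> 'a measure) measure)"
  have u: "?u \<in> space (?PM 0)" by (simp add: space_PiM)
  show ?case
  \<comment> \<open>Finite measures on the finite product are compared on boxes
    \<open>PiE {0..<Suc n} G\<close>.\<close>
  proof (rule measure_eqI_PiM_finite[where I="{0..<Suc n}" and M="\<lambda>_. unit_paths"
        and A="\<lambda>_. space (?PM (Suc n))"])
    show "sets (IT.C 0 (Suc n) ?u) = sets (?PM (Suc n))"
      using IT.sets_C[OF u, of "Suc n"] by simp
    show "range (\<lambda>_. space (?PM (Suc n))) \<subseteq> prod_algebra {0..<Suc n} (\<lambda>_. unit_paths)"
      by (auto simp: space_PiM intro!: prod_algebraI_finite measure_paths_in_unit_paths)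
    show "emeasure (IT.C 0 (Suc n) ?u) (space (?PM (Suc n))) \<noteq> \<infinity>"
      using prob_space.emeasure_space_1[OF IT.prob_space_C[OF u, of "Suc n"]] IT.space_C[OF u, of "Suc n"]
      by simp
    fix G :: "nat \<Rightarrow> (real \<Rightarrow> 'a measure) set"
    assume G: "\<And>i. i \<in> {0..<Suc n} \<Longrightarrow> G i \<in> sets unit_paths"
    let ?B = "\<lambda>n. PiE {0..<n} G"
    have B: "?B (Suc n) \<in> sets (?PM (Suc n))" "?B n \<in> sets (?PM n)"
      using G by (auto intro!: sets_PiM_I_finite)
    have Gn: "G n \<in> sets unit_paths" using G by simp
    have Gp: "G n \<in> sets path_algebra" using Gn path_filtration_le_path_algebra[of 1] by auto
    obtain m where m: "n = Suc m" using Suc.hyps by (cases n) auto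
    \<comment> \<open>The event that the first \<open>n\<close> pieces lie in their box is known at
      time \<open>n\<close>, as the Markov property requires.\<close>
    define E where "E = pieces n -` ?B n \<inter> measure_paths"
    have E: "E \<in> sets (path_filtration (real n))"
      using measurable_sets[OF measurable_pieces_filtration B(2)] by (simp add: E_def)
    have Ep: "E \<in> sets path_algebra" using E path_filtration_le_path_algebra[of "real n"] by auto
    have ne: "space (IT.C 0 n ?u) \<noteq> {}"
      using IT.space_C[OF u, of n] prob_space.not_empty[OF IT.prob_space_C[OF u, of n]] by simp
    have eval: "(\<lambda>\<omega>. \<omega> m 1) \<in> measurable (?PM n) finite_measure_algebra"
      unfolding m by (intro measurable_piece_eval) auto
    have km: "(\<lambda>\<omega>. emeasure (step_kernel (\<omega> m 1)) (G n)) \<in> borel_measurable (?PM n)"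
      by (rule measurable_compose[OF eval measurable_emeasure_kernel[OF measurable_step_kernel Gn]])
    have eP: "emeasure (IT.eP n \<omega>) (?B (Suc n)) = indicator (?B n) \<omega> * emeasure (step_kernel (\<omega> m 1)) (G n)"
      if \<omega>: "\<omega> \<in> space (?PM n)" for \<omega>
    proof -
      \<comment> \<open>Appending a piece lands in the larger box exactly when the old sequence lies
        in the smaller box and the new piece in \<open>G n\<close>.\<close>
      have "(\<lambda>x. fun_upd \<omega> n x) -` ?B (Suc n) \<inter> space unit_paths = (if \<omega> \<in> ?B n then G n else {})"
        using \<omega> sets.sets_into_space[OF Gn]
        by (auto simp: space_PiM PiE_iff extensional_def atLeast0_lessThan_Suc)
      then show ?thesis
        unfolding IT.emeasure_eP[OF \<omega> B(1)] by (simp add: m chain_def)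
    qed
    have "emeasure (IT.C 0 (Suc n) ?u) (?B (Suc n))
        = (\<integral>\<^sup>+\<omega>. emeasure (IT.eP n \<omega>) (?B (Suc n)) \<partial>IT.C 0 n ?u)"
      using emeasure_bind[OF ne _ B(1), of "IT.eP n"] IT.measurable_eP[of n]
      by (simp add: measurable_cong_sets[OF IT.sets_C[OF u] refl])
    also have "\<dots> = (\<integral>\<^sup>+\<omega>. indicator (?B n) \<omega> * emeasure (step_kernel (\<omega> m 1)) (G n) \<partial>IT.C 0 n ?u)"
      by (intro nn_integral_cong eP) (simp add: IT.space_C[OF u])
    also have "\<dots> = (\<integral>\<^sup>+X. indicator (?B n) (pieces n X) * emeasure (step_kernel (pieces n X m 1)) (G n) \<partial>biased n)"
      unfolding Suc.IH
      by (rule nn_integral_distr)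
         (use B km measurable_pieces in \<open>simp_all add: measurable_cong_sets[OF sets_biased refl]\<close>)
    also have "\<dots> = (\<integral>\<^sup>+X. indicator E X * emeasure (step_kernel (X (real n))) (G n) \<partial>biased n)"
      by (intro nn_integral_cong)
         (auto simp: E_def space_biased pieces_def m shift_path_def ac_simps indicator_def)
    also have "\<dots> = (\<integral>\<^sup>+X. emeasure (X (real n)) UNIV *
        (indicator E X * emeasure (step_kernel (X (real n))) (G n)) \<partial>N)"
      using Ep measurable_compose[OF measurable_path_eval_algebra[of "real n"]
          measurable_emeasure_kernel[OF measurable_step_kernel Gn]]
      by (intro nn_integral_biased) simp
    \<comment> \<open>The weight at time \<open>n\<close> cancels the denominator of the tilt,
      leaving the mass at the end of the new piece.\<close>
    also have "\<dots> = (\<integral>\<^sup>+X. indicator E X *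
        (\<integral>\<^sup>+Y. emeasure (Y 1) UNIV * indicator (G n) Y \<partial>P (X (real n))) \<partial>N)"
    proof (intro nn_integral_cong)
      fix X assume "X \<in> space N"
      then have "emeasure (X (real n)) UNIV * emeasure (step_kernel (X (real n))) (G n)
          = (\<integral>\<^sup>+Y. emeasure (Y 1) UNIV * indicator (G n) Y \<partial>P (X (real n)))"
        by (intro step_kernel_mass[OF _ Gn]) (simp add: space_N path_in_finite_borel_measures)
      then show "emeasure (X (real n)) UNIV * (indicator E X * emeasure (step_kernel (X (real n))) (G n))
          = indicator E X * (\<integral>\<^sup>+Y. emeasure (Y 1) UNIV * indicator (G n) Y \<partial>P (X (real n)))"
        by (subst mult.left_commute) (simp only:)
    qed
    \<comment> \<open>The Markov property is read backwards: the independent-looking piece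
      \<open>Y\<close> becomes the continuation of \<open>X\<close> after time
      \<open>n\<close>.\<close>
    also have "\<dots> = (\<integral>\<^sup>+X. indicator E X *
        (emeasure (shift_path (real n) X 1) UNIV * indicator (G n) (shift_path (real n) X)) \<partial>N)"
      using measurable_mass[of 1] Gp Suc.hyps by (intro markov_N[OF _ E, symmetric] borel_measurable_times_ennreal) simp_all
    also have "\<dots> = (\<integral>\<^sup>+X. emeasure (X (real (Suc n))) UNIV *
        indicator (pieces (Suc n) -` ?B (Suc n) \<inter> measure_paths) X \<partial>N)"
      by (intro nn_integral_cong)
         (auto simp: space_N E_def pieces_def shift_path_def PiE_iff less_Suc_eq ac_simps indicator_def)
    also have "\<dots> = emeasure (biased (Suc n)) (pieces (Suc n) -` ?B (Suc n) \<inter> measure_paths)"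
      using measurable_sets[OF measurable_pieces B(1)] by (simp only: emeasure_biased space_path_algebra)
    also have "\<dots> = emeasure (distr (biased (Suc n)) (?PM (Suc n)) (pieces (Suc n))) (?B (Suc n))"
      using measurable_pieces B(1)
      by (subst emeasure_distr) (simp_all add: measurable_cong_sets[OF sets_biased refl] space_biased)
    finally show "emeasure (IT.C 0 (Suc n) ?u) (?B (Suc n))
        = emeasure (distr (biased (Suc n)) (?PM (Suc n)) (pieces (Suc n))) (?B (Suc n))" .
  qed simp_all
qed

section \<open>The infinite chain and the law of the glued path\<close>

abbreviation "pieces_lim \<equiv> IT.PF.lim"

text \<open>The finite-dimensional marginals of the infinite chain are the laws
  \<open>IT.C 0 n\<close>, which \<open>pieces_law\<close> identifies with the laws of pieces cut
  from a single path.\<close>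

lemma emeasure_pieces_lim:
  assumes n: "1 \<le> n" and B: "B \<in> sets (PiM {0..<n} (\<lambda>_. unit_paths))"
  shows "{\<omega> \<in> space pieces_lim. restrict \<omega> {0..<n} \<in> B} \<in> sets pieces_lim"
    "emeasure pieces_lim {\<omega> \<in> space pieces_lim. restrict \<omega> {0..<n} \<in> B}
      = emeasure (biased n) {X \<in> measure_paths. pieces n X \<in> B}"
proof -
  have emb: "prod_emb UNIV (\<lambda>_. unit_paths) {0..<n} B = {\<omega> \<in> space pieces_lim. restrict \<omega> {0..<n} \<in> B}"
    by (auto simp: prod_emb_def space_PiM_paths)
  show "{\<omega> \<in> space pieces_lim. restrict \<omega> {0..<n} \<in> B} \<in> sets pieces_lim"
    unfolding emb[symmetric] IT.PF.sets_lim using B by (intro measurable_prod_emb) auto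
  have "emeasure pieces_lim (prod_emb UNIV (\<lambda>_. unit_paths) {0..<n} B) = emeasure (IT.CI {0..<n}) B"
    using B by (intro IT.lim) auto
  also have "\<dots> = emeasure (IT.C 0 n (\<lambda>_. undefined)) B"
    using B sets.sets_into_space[OF B] by (subst IT.emeasure_CI[of _ n]) (auto simp: space_PiM prod_emb_id)
  also have "\<dots> = emeasure (biased n) (pieces n -` B \<inter> space (biased n))"
    unfolding pieces_law[OF n] using measurable_pieces B
    by (intro emeasure_distr) (simp_all add: measurable_cong_sets[OF sets_biased refl])
  also have "pieces n -` B \<inter> space (biased n) = {X \<in> measure_paths. pieces n X \<in> B}"
    by (auto simp: space_biased)
  finally show "emeasure pieces_lim {\<omega> \<in> space pieces_lim. restrict \<omega> {0..<n} \<in> B}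
      = emeasure (biased n) {X \<in> measure_paths. pieces n X \<in> B}"
    unfolding emb .
qed

lemma prob_space_pieces_lim: "prob_space pieces_lim"
proof
  have "{\<omega> \<in> space pieces_lim. restrict \<omega> {0..<1} \<in> space (PiM {0..<1} (\<lambda>_. unit_paths))} = space pieces_lim"
    by (auto simp: space_PiM_paths space_PiM)
  moreover have "{X \<in> measure_paths. pieces 1 X \<in> space (PiM {0..<1} (\<lambda>_. unit_paths))} = space (biased 1)"
    using measurable_space[OF measurable_pieces[of 1]] by (auto simp: space_biased)
  ultimately show "emeasure pieces_lim (space pieces_lim) = 1"
    using emeasure_pieces_lim(2)[of 1 "space (PiM {0..<1} (\<lambda>_. unit_paths))"]
      prob_space.emeasure_space_1[OF prob_space_biased[of 1]] by simp
qed

lemma measurable_pieces_lim_eval: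
  "0 \<le> r \<Longrightarrow> r \<le> 1 \<Longrightarrow> (\<lambda>\<omega>. \<omega> k r) \<in> measurable pieces_lim finite_measure_algebra"
  unfolding measurable_cong_sets[OF IT.PF.sets_lim refl]
  by (rule measurable_piece_eval) auto

lemma sets_compatible: "{\<omega> \<in> space pieces_lim. compatible \<omega>} \<in> sets pieces_lim"
  unfolding compatible_def
  by (intro sets.sets_Collect_countable_All measurable_eq_finite_borel_measure
      measurable_pieces_lim_eval) auto

text \<open>A mismatch between pieces \<open>k\<close> and \<open>Suc k\<close> is an event of the
  first \<open>Suc (Suc k)\<close> pieces. Its probability can be computed for pieces cut from one
  path, where no mismatch can occur.\<close>

lemma AE_compatible: "AE \<omega> in pieces_lim. compatible \<omega>"
  unfolding compatible_def AE_all_countable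
proof
  fix k
  let ?PM = "PiM {0..<Suc (Suc k)} (\<lambda>_. unit_paths :: (real \<Rightarrow> 'a measure) measure)"
  let ?B = "space ?PM - {\<omega> \<in> space ?PM. \<omega> (Suc k) 0 = \<omega> k 1}"
  have B: "?B \<in> sets ?PM"
    by (intro sets.compl_sets measurable_eq_finite_borel_measure
        measurable_piece_eval) auto
  have empty: "{X \<in> measure_paths. pieces (Suc (Suc k)) X \<in> ?B} = {}"
    by (auto simp: pieces_def shift_path_def ac_simps)
  have "emeasure pieces_lim {\<omega> \<in> space pieces_lim. restrict \<omega> {0..<Suc (Suc k)} \<in> ?B}
      = emeasure (biased (Suc (Suc k))) {X \<in> measure_paths. pieces (Suc (Suc k)) X \<in> ?B}"
    by (rule emeasure_pieces_lim(2)[OF _ B]) simp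
  then have "emeasure pieces_lim {\<omega> \<in> space pieces_lim. restrict \<omega> {0..<Suc (Suc k)} \<in> ?B} = 0"
    unfolding empty emeasure_empty .
  moreover have "{\<omega> \<in> space pieces_lim. restrict \<omega> {0..<Suc (Suc k)} \<in> ?B}
      = {\<omega> \<in> space pieces_lim. \<not> \<omega> (Suc k) 0 = \<omega> k 1}"
    by (auto simp: space_PiM space_PiM_paths)
  ultimately show "AE \<omega> in pieces_lim. \<omega> (Suc k) 0 = \<omega> k 1"
    using emeasure_pieces_lim(1)[OF _ B] by (intro AE_I[OF subset_refl]) auto
qed

text \<open>Incompatible sequences form a null set, but there \<open>glue\<close> need not be
  continuous; the zero path is substituted so that every value lies in the path space.\<close>

definition glue_total :: "(nat \<Rightarrow> real \<Rightarrow> 'a measure) \<Rightarrow> real \<Rightarrow> 'a measure" where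
  "glue_total \<omega> = (if compatible \<omega> then glue \<omega> else (\<lambda>t\<in>{0..}. null_measure borel))"

definition limit_law :: "(real \<Rightarrow> 'a measure) measure" where
  "limit_law = distr pieces_lim path_algebra glue_total"

lemma measurable_glue_total: "glue_total \<in> measurable pieces_lim path_algebra"
proof (rule measurable_into_path_algebra)
  fix \<omega> assume "\<omega> \<in> space pieces_lim"
  then show "glue_total \<omega> \<in> measure_paths"
    by (auto simp: glue_total_def space_PiM_paths constant_null_path intro!: glue_in_measure_paths)
next
  fix r :: real assume r: "0 \<le> r"
  have 0: "(null_measure borel :: 'a measure) \<in> finite_borel_measures"
    using path_in_finite_borel_measures[OF constant_null_path, of 0] by simp
  have "(\<lambda>\<omega>. if compatible \<omega> then \<omega> (nat \<lfloor>r\<rfloor>) (r - real (nat \<lfloor>r\<rfloor>)) else null_measure borel)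
      \<in> measurable pieces_lim finite_measure_algebra"
    using r sets_compatible 0
    by (intro measurable_If measurable_pieces_lim_eval measurable_const) (auto, linarith+)
  moreover have "glue_total \<omega> r = (if compatible \<omega> then \<omega> (nat \<lfloor>r\<rfloor>) (r - real (nat \<lfloor>r\<rfloor>)) else null_measure borel)" for \<omega>
    using r by (simp add: glue_total_def glue_def)
  ultimately show "(\<lambda>\<omega>. glue_total \<omega> r) \<in> measurable pieces_lim finite_measure_algebra"
    by simp
qed

lemma prob_space_limit_law: "prob_space limit_law"
  unfolding limit_law_def
  by (intro prob_space.prob_space_distr prob_space_pieces_lim measurable_glue_total)

lemma sets_limit_law: "sets limit_law = sets path_algebra"
  by (simp add: limit_law_def)

text \<open>One cylinder base \<open>B\<close> describes \<open>E\<close> both for glued sequences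
  and for the pieces of a genuine path, so the marginals of the chain give the probability of
  \<open>E\<close>.\<close>

lemma limit_law_eq:
  assumes n: "1 \<le> n" and E: "E \<in> sets (path_filtration (real n))"
  shows "emeasure limit_law E = (\<integral>\<^sup>+X. indicator E X * emeasure (X (real n)) UNIV \<partial>N)"
proof -
  have Ep: "E \<in> sets path_algebra" using E path_filtration_le_path_algebra[of "real n"] by auto
  obtain B where B: "B \<in> sets (PiM {0..<n} (\<lambda>_. unit_paths))"
    and eq: "\<And>\<omega>. (\<forall>k. \<omega> k \<in> measure_paths) \<Longrightarrow> compatible \<omega> \<Longrightarrow> (glue \<omega> \<in> E \<longleftrightarrow> restrict \<omega> {0..<n} \<in> B)"
    using glue_cylinder[OF n E] by blast
  have "emeasure limit_law E = emeasure pieces_lim (glue_total -` E \<inter> space pieces_lim)"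
    unfolding limit_law_def by (rule emeasure_distr[OF measurable_glue_total Ep])
  also have "\<dots> = emeasure pieces_lim {\<omega> \<in> space pieces_lim. restrict \<omega> {0..<n} \<in> B}"
  \<comment> \<open>The two events are compared only on compatible sequences; elsewhere
    \<open>glue_total\<close> is the zero path.\<close>
  proof (rule emeasure_eq_AE)
    show "AE \<omega> in pieces_lim. \<omega> \<in> glue_total -` E \<inter> space pieces_lim \<longleftrightarrow>
        \<omega> \<in> {\<omega> \<in> space pieces_lim. restrict \<omega> {0..<n} \<in> B}"
      using AE_compatible AE_space
      by eventually_elim (use eq in \<open>auto simp: glue_total_def space_PiM_paths\<close>)
  qed (use measurable_sets[OF measurable_glue_total Ep] emeasure_pieces_lim(1)[OF n B] in auto)
  also have "\<dots> = emeasure (biased n) {X \<in> measure_paths. pieces n X \<in> B}"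
    by (rule emeasure_pieces_lim(2)[OF n B])
  also have "{X \<in> measure_paths. pieces n X \<in> B} = E"
  proof -
    have "pieces n X \<in> B \<longleftrightarrow> X \<in> E" if X: "X \<in> measure_paths" for X
      using eq[of "\<lambda>k. shift_path (real k) X"] compatible_shift_path[of X] glue_shift_path[OF X]
        shift_path_in_measure_paths[OF X] by (simp add: pieces_def)
    then show ?thesis using sets.sets_into_space[OF E] by auto
  qed
  also have "emeasure (biased n) E = (\<integral>\<^sup>+X. indicator E X * emeasure (X (real n)) UNIV \<partial>N)"
    by (simp add: emeasure_biased[OF Ep] mult.commute)
  finally show ?thesis .
qed

section \<open>The martingale property and convergence of the two conditionings\<close>

text \<open>Conditionally on the path up to time \<open>s\<close>, the later mass has mean
  \<open>X s\<close> of the whole space, by the Markov property and \<open>mass_P\<close>.\<close>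

lemma mass_martingale:
  assumes s: "0 < s" and E: "E \<in> sets (path_filtration s)" and t: "s \<le> t"
  shows "(\<integral>\<^sup>+X. indicator E X * emeasure (X t) UNIV \<partial>N) = (\<integral>\<^sup>+X. indicator E X * emeasure (X s) UNIV \<partial>N)"
proof (cases "s = t")
  case False
  then have t: "0 < t - s" using t by simp
  have "(\<integral>\<^sup>+X. indicator E X * emeasure (X t) UNIV \<partial>N)
      = (\<integral>\<^sup>+X. indicator E X * emeasure (shift_path s X (t - s)) UNIV \<partial>N)"
    using t by (simp add: shift_path_def)
  also have "\<dots> = (\<integral>\<^sup>+X. indicator E X * (\<integral>\<^sup>+Y. emeasure (Y (t - s)) UNIV \<partial>P (X s)) \<partial>N)"
    using t by (intro markov_N[OF s E] measurable_mass) simp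
  also have "\<dots> = (\<integral>\<^sup>+X. indicator E X * emeasure (X s) UNIV \<partial>N)"
    using s t by (intro nn_integral_cong) (simp add: space_N mass_P path_in_finite_borel_measures)
  finally show ?thesis .
qed simp

text \<open>An event known at time \<open>s\<close> is also known at a later integer time, where
  \<open>limit_law_eq\<close> applies; the martingale property moves the weight back to time
  \<open>s\<close>.\<close>

lemma limit_law_eq_real:
  assumes s: "0 < s" and E: "E \<in> sets (path_filtration s)"
  shows "emeasure limit_law E = (\<integral>\<^sup>+X. indicator E X * emeasure (X s) UNIV \<partial>N)"
proof -
  obtain n :: nat where n: "s \<le> real n" using real_arch_simple by blast
  then have "1 \<le> n" using s by (cases n) auto
  then have "emeasure limit_law E = (\<integral>\<^sup>+X. indicator E X * emeasure (X (real n)) UNIV \<partial>N)"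
    using E path_filtration_mono[OF n] by (intro limit_law_eq) auto
  then show ?thesis using mass_martingale[OF s E n] by simp
qed

text \<open>The denominator is 1 and the numerator is constant for \<open>t\<close> beyond
  \<open>s\<close>, so the limit is already attained at time \<open>s\<close>.\<close>

lemma mass_biased_tendsto:
  assumes s: "0 < s" and E: "E \<in> sets (path_filtration s)"
  shows "((\<lambda>t. mass_biased N t E) \<longlongrightarrow> emeasure limit_law E) at_top"
proof (rule tendsto_eventually)
  show "eventually (\<lambda>t. mass_biased N t E = emeasure limit_law E) at_top"
    using eventually_ge_at_top[of s]
  proof eventually_elim
    case (elim t)
    then show ?case
      using s mass_martingale[OF s E elim] by (simp add: mass_biased_def mass_N limit_law_eq_real[OF s E] divide_ennreal_def)
  qed
qed

text \<open>The Markov property at time \<open>s\<close> replaces survival until \<open>t\<close> by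
  its conditional probability given \<open>X s\<close>. For large \<open>t\<close> this is
  approximately \<open>2 / (t - s)\<close> times the mass at time \<open>s\<close>, and the
  normalisation is \<open>2 / t\<close>.\<close>

lemma survival_conditioned_tendsto:
  assumes s: "0 < s" and E: "E \<in> sets (path_filtration s)"
  shows "((\<lambda>t. survival_conditioned N t E) \<longlongrightarrow> emeasure limit_law E) at_top"
proof (rule tendsto_at_topI_sequentially)
  fix T :: "nat \<Rightarrow> real" assume T: "filterlim T at_top sequentially"
  have Ep: "E \<in> sets path_algebra"
    using E path_filtration_le_path_algebra[of s] s by auto
  \<comment> \<open>The factor \<open>(t - s) / 2\<close> rescales the survival probability so that
    it tends from below to the mass at time \<open>s\<close>. The compensating ratio of
    \<open>2 / (t - s)\<close> to \<open>2 / t\<close> is \<open>t / (t - s)\<close>, which tends to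
    1.\<close>
  let ?w = "\<lambda>t X. indicator E X * ennreal ((t - s) / 2 * (1 - exp (- (measure (X s) UNIV / ((t - s) / 2)))))"
  have w_meas: "?w t \<in> borel_measurable N" for t
  proof -
    have [measurable]: "(\<lambda>X. measure (X s) UNIV) \<in> borel_measurable (path_algebra :: (real \<Rightarrow> 'a measure) measure)"
      using s by (intro measurable_mass_real) simp
    note Ep [measurable]
    show ?thesis unfolding measurable_cong_sets[OF sets_N refl] by measurable
  qed
  have surv: "survival_conditioned N t E = ennreal (t / (t - s)) * (\<integral>\<^sup>+X. ?w t X \<partial>N)" if t: "s < t" for t
  proof -
    have ts: "0 < t - s" using t by simp
    have surv_meas: "(indicator {X :: real \<Rightarrow> 'a measure. emeasure (X (t - s)) UNIV > 0} :: _ \<Rightarrow> ennreal) \<in> borel_measurable path_algebra"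
    proof -
      have "(\<lambda>X. indicator {0<..} (emeasure (X (t - s)) UNIV) :: ennreal)
          \<in> borel_measurable (path_algebra :: (real \<Rightarrow> 'a measure) measure)"
        using ts by (intro measurable_compose[OF measurable_mass borel_measurable_indicator]) auto
      moreover have "(indicator {X :: real \<Rightarrow> 'a measure. emeasure (X (t - s)) UNIV > 0} :: _ \<Rightarrow> ennreal) = (\<lambda>X. indicator {0<..} (emeasure (X (t - s)) UNIV))"
        by (auto simp: indicator_def fun_eq_iff)
      ultimately show ?thesis by simp
    qed
    have "(\<integral>\<^sup>+X. indicator E X * indicator {X. emeasure (X t) UNIV > 0} X \<partial>N)
        = (\<integral>\<^sup>+X. indicator E X * indicator {X. emeasure (X (t - s)) UNIV > 0} (shift_path s X) \<partial>N)"
      using ts by (intro nn_integral_cong) (simp add: shift_path_def indicator_def)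
    also have "\<dots> = (\<integral>\<^sup>+X. indicator E X *
        (\<integral>\<^sup>+Y. indicator {X. emeasure (X (t - s)) UNIV > 0} Y \<partial>P (X s)) \<partial>N)"
      by (rule markov_N[OF s E surv_meas])
    also have "\<dots> = (\<integral>\<^sup>+X. ennreal (2 / (t - s)) * ?w t X \<partial>N)"
    proof (intro nn_integral_cong)
      fix X assume "X \<in> space N"
      then have "(\<integral>\<^sup>+Y. indicator {X. emeasure (X (t - s)) UNIV > 0} Y \<partial>P (X s))
          = ennreal (1 - exp (- (2 * measure (X s) UNIV / (t - s))))"
        using s ts by (intro survival_P) (auto simp: space_N path_in_finite_borel_measures)
      also have "\<dots> = ennreal (2 / (t - s) * ((t - s) / 2 * (1 - exp (- (measure (X s) UNIV / ((t - s) / 2))))))"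
      proof -
        have cancel: "2 / (t - s) * ((t - s) / 2 * c) = c" for c
          using ts by (simp add: field_simps)
        show ?thesis unfolding cancel by (simp add: mult.commute)
      qed
      also have "\<dots> = ennreal (2 / (t - s)) *
          ennreal ((t - s) / 2 * (1 - exp (- (measure (X s) UNIV / ((t - s) / 2)))))"
        using ts by (intro ennreal_mult') simp
      finally show "indicator E X * (\<integral>\<^sup>+Y. indicator {X. emeasure (X (t - s)) UNIV > 0} Y \<partial>P (X s))
          = ennreal (2 / (t - s)) * ?w t X"
        by (subst mult.left_commute) (simp only:)
    qed
    also have "\<dots> = ennreal (2 / (t - s)) * (\<integral>\<^sup>+X. ?w t X \<partial>N)"
      by (rule nn_integral_cmult[OF w_meas])
    finally have "survival_conditioned N t E = ennreal (2 / (t - s)) * (\<integral>\<^sup>+X. ?w t X \<partial>N) / ennreal (2 / t)"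
      using s t by (simp add: survival_conditioned_def survival_N)
    also have "\<dots> = ennreal (2 / (t - s)) / ennreal (2 / t) * (\<integral>\<^sup>+X. ?w t X \<partial>N)"
      by (simp add: divide_ennreal_def ac_simps)
    also have "ennreal (2 / (t - s)) / ennreal (2 / t) = ennreal (t / (t - s))"
      using s t by (subst divide_ennreal) (auto simp: field_simps)
    finally show ?thesis .
  qed
  have pos: "\<forall>\<^sub>F n in sequentially. s < T n"
    using T by (simp add: filterlim_at_top_dense)
  have "filterlim (\<lambda>t. (t - s) / 2) at_top at_top" by real_asymp
  then have T': "filterlim (\<lambda>n. (T n - s) / 2) at_top sequentially"
    by (rule filterlim_compose[OF _ T])
  have "(\<lambda>n. \<integral>\<^sup>+X. ?w (T n) X \<partial>N) \<longlonglongrightarrow> (\<integral>\<^sup>+X. indicator E X * emeasure (X s) UNIV \<partial>N)"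
  proof (rule nn_integral_tendsto_from_below)
    show "?w (T n) \<in> borel_measurable N" for n by (rule w_meas)
    show "\<forall>\<^sub>F n in sequentially. \<forall>X\<in>space N. ?w (T n) X \<le> indicator E X * emeasure (X s) UNIV"
      using pos
    proof eventually_elim
      case (elim n)
      define \<tau> where "\<tau> = (T n - s) / 2"
      have \<tau>: "0 < \<tau>" using elim by (simp add: \<tau>_def)
      have "\<tau> * (1 - exp (- (y / \<tau>))) \<le> y" for y
        using mult_left_mono[OF one_minus_exp_le[of "y / \<tau>"], of \<tau>] \<tau> by simp
      then show ?case
        using s unfolding \<tau>_def[symmetric]
        by (auto simp: space_N emeasure_path intro!: mult_left_mono ennreal_leI)
    qed
    fix X assume "X \<in> space N"
    then have "emeasure (X s) UNIV = ennreal (measure (X s) UNIV)"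
      using s by (simp add: space_N emeasure_path)
    then show "(\<lambda>n. ?w (T n) X) \<longlonglongrightarrow> indicator E X * emeasure (X s) UNIV"
      using tendsto_ennrealI[OF tendsto_scaled_one_minus_exp[OF T', of "measure (X s) UNIV"]]
      by (auto simp: indicator_def)
  qed
  moreover have "((\<lambda>t. t / (t - s)) \<longlongrightarrow> 1) at_top" by real_asymp
  then have "(\<lambda>n. ennreal (T n / (T n - s))) \<longlonglongrightarrow> ennreal 1"
    by (intro tendsto_ennrealI filterlim_compose[OF _ T])
  moreover have fin: "emeasure limit_law E \<noteq> \<infinity>"
    using prob_space.emeasure_le_1[OF prob_space_limit_law, of E] by (auto simp: top_unique)
  ultimately have "(\<lambda>n. ennreal (T n / (T n - s)) * (\<integral>\<^sup>+X. ?w (T n) X \<partial>N)) \<longlonglongrightarrow> 1 * emeasure limit_law E"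
    unfolding limit_law_eq_real[OF s E, symmetric] by (intro tendsto_mult_ennreal) auto
  moreover have "eventually (\<lambda>n. survival_conditioned N (T n) E
      = ennreal (T n / (T n - s)) * (\<integral>\<^sup>+X. ?w (T n) X \<partial>N)) sequentially"
    using pos by eventually_elim (rule surv)
  ultimately show "(\<lambda>n. survival_conditioned N (T n) E) \<longlonglongrightarrow> emeasure limit_law E"
    by (simp add: tendsto_cong)
qed

end

theorem theorem3p1:
  fixes P :: "'a::euclidean_space measure \<Rightarrow> (real \<Rightarrow> 'a measure) measure"
    and N0 :: "(real \<Rightarrow> 'a measure) measure"
  assumes "super_brownian_laws P"
    and "canonical_measure P N0"
  shows "\<exists>P_inf Q_inf.
     prob_space P_inf \<and> sets P_inf = sets path_algebra \<and>
     prob_space Q_inf \<and> sets Q_inf = sets path_algebra \<and>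
     (\<forall>s\<ge>0. \<forall>E\<in>sets (path_filtration s).
        ((\<lambda>t. mass_biased N0 t E) \<longlongrightarrow> emeasure P_inf E) at_top \<and>
        ((\<lambda>t. survival_conditioned N0 t E) \<longlongrightarrow> emeasure Q_inf E) at_top) \<and>
     P_inf = Q_inf"
proof -
  interpret super_brownian_motion P N0 by unfold_locales (fact assms)+
  have "((\<lambda>t. mass_biased N0 t E) \<longlongrightarrow> emeasure limit_law E) at_top \<and>
      ((\<lambda>t. survival_conditioned N0 t E) \<longlongrightarrow> emeasure limit_law E) at_top"
    if "E \<in> sets (path_filtration s)" for s E
  proof -
    \<comment> \<open>The Markov property under the canonical measure starts at positive times, so
      \<open>E\<close> is regarded as an event of a time at least 1; this covers
      \<open>s = 0\<close>.\<close>
    have "E \<in> sets (path_filtration (max s 1))"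
      using that path_filtration_mono[of s "max s 1"] by auto
    then show ?thesis
      using mass_biased_tendsto[of "max s 1" E] survival_conditioned_tendsto[of "max s 1" E] by simp
  qed
  then show ?thesis
    using prob_space_limit_law sets_limit_law by (intro exI[of _ limit_law]) blast
qed

end
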